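(* Let $n>0$ and $k>2$ be integers, let $\Delta_n$ be a knot sequence on $[0,1]$ as in the context, let $S_{\Delta_n,k}$ be the associated Schoenberg operator, and let $0<t\le \frac12$. Then $\omega_2(f,t)\sim\|f-S_{\Delta_n,k}f\|_\infty$ in the sense that there exist constants $M_1,M_2>0$, independent of $f$ and only depending on $\Delta_n$ and $k$, such that for all $f\in C([0,1])$ $$M_1\cdot\omega_2(f,t)\le \|f-S_{\Delta_n,k}f\|_\infty\le M_2\cdot\omega_2(f,t).$$
   Context: $C([0,1])$ is the Banach space of real-valued continuous functions on $[0,1]$ with the uniform norm $\|\cdot\|_\infty$. Knots: for integers $n,k>0$, $\Delta_n=\{x_j\}_{j=-k}^{n+k}$ satisfies $x_{-k}=\cdots=x_0=0<x_1<\cdots<x_n=\cdots=x_{n+k}=1$. Normalized B-splines of degree $k$: for $-k\le j\le n-1$, $N_{j,k}(x)=(x_{j+k+1}-x_j)\,[x_j,\ldots,x_{j+k+1}](\cdot-x)_+^k$, where $y_+^k=y^k$ for $y>0$ and $0$ for $y\le0$, and $[x_j,\ldots,x_{j+k+1}]g$ is the divided difference, i.e. the leading coefficient (of degree $k+1$) of the polynomial of degree at most $k+1$ interpolating $g$ at $x_j,\ldots,x_{j+k+1}$ (Hermite interpolation at repeated points); the value at $x=0$ is the right limit. Greville nodes: $\xi_{j,k}=\frac{x_{j+1}+\cdots+x_{j+k}}{k}$, $-k\le j\le n-1$. Schoenberg operator: $S_{\Delta_n,k}f(x)=\sum_{j=-k}^{n-1}f(\xi_{j,k})N_{j,k}(x)$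 for $0\le x<1$, and $S_{\Delta_n,k}f(1)=\lim_{y\nearrow1}S_{\Delta_n,k}f(y)$. Second modulus of smoothness, for $0<t\le\frac12$: $\omega_2(f,t)=\sup_{0<h<t}\sup\{|f(x)-2f(x+h)+f(x+2h)| : x\in[0,1-2h]\}$.
   Formalization: The constant M_2 is allowed to depend on t as well as on Δ_n and k; a choice independent of t is impossible, since for f(x)=x² the modulus ω_2(f,t)=2t² tends to 0 while ‖f−Sf‖ is fixed and positive. M_1 depends only on Δ_n and k, as stated. *)

theory Defs
  imports "HOL-Analysis.Analysis" "HOL-Computational_Algebra.Polynomial"
begin

text \<open>
  Knots are indexed by integers; only the values \<open>x j\<close> with \<open>-k \<le> j \<le> n + k\<close> matter.
\<close>

definition knot_sequence :: "nat \<Rightarrow> nat \<Rightarrow> (int \<Rightarrow> real) \<Rightarrow> bool" where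
  "knot_sequence n k x \<longleftrightarrow>
     (\<forall>j\<in>{- int k..0}. x j = 0) \<and>
     (\<forall>j\<in>{0..<int n}. x j < x (j + 1)) \<and>
     (\<forall>j\<in>{int n..int n + int k}. x j = 1)"

text \<open>
  Hermite interpolation: a point occurring \<open>m\<close> times in the list of nodes prescribes
  the derivatives of orders \<open>0, \<dots>, m - 1\<close> at that point.
\<close>

definition hermite_interpolates :: "real poly \<Rightarrow> (real \<Rightarrow> real) \<Rightarrow> real list \<Rightarrow> bool" where
  "hermite_interpolates p g ys \<longleftrightarrow>
     (\<forall>y\<in>set ys. \<forall>i<count_list ys y. poly ((pderiv ^^ i) p) y = (deriv ^^ i) g y)"

definition divided_difference :: "real list \<Rightarrow> (real \<Rightarrow> real) \<Rightarrow> real" where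
  "divided_difference ys g =
     coeff (THE p. degree p \<le> length ys - 1 \<and> hermite_interpolates p g ys) (length ys - 1)"

definition trunc_power :: "nat \<Rightarrow> real \<Rightarrow> real" where
  "trunc_power k y = (if y > 0 then y ^ k else 0)"

text \<open>
  At \<open>u = 0\<close> the right limit is taken, because for \<open>j = -k\<close> the node \<open>0\<close> has multiplicity
  \<open>k + 1\<close> and the truncated power has no \<open>k\<close>-th derivative at its own knot. At \<open>u = 1\<close> the
  same problem occurs, but the Schoenberg operator below does not use the value there.
\<close>

definition bspline :: "(int \<Rightarrow> real) \<Rightarrow> int \<Rightarrow> nat \<Rightarrow> real \<Rightarrow> real" where
  "bspline x j k u =
     (let B = (\<lambda>v. (x (j + int k + 1) - x j) *
                 divided_difference (map x [j..j + int k + 1]) (\<lambda>y. trunc_power k (y - v)))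
      in if u = 0 then Lim (at_right 0) B else B u)"

definition greville :: "(int \<Rightarrow> real) \<Rightarrow> int \<Rightarrow> nat \<Rightarrow> real" where
  "greville x j k = (\<Sum>i = j + 1..j + int k. x i) / real k"

definition schoenberg :: "nat \<Rightarrow> nat \<Rightarrow> (int \<Rightarrow> real) \<Rightarrow> (real \<Rightarrow> real) \<Rightarrow> real \<Rightarrow> real" where
  "schoenberg n k x f u =
     (let S = (\<lambda>v. \<Sum>j = - int k..int n - 1. f (greville x j k) * bspline x j k v)
      in if u < 1 then S u else Lim (at_left 1) S)"

definition sup_norm :: "(real \<Rightarrow> real) \<Rightarrow> real" where
  "sup_norm g = (SUP u\<in>{0..1}. \<bar>g u\<bar>)"

definition omega2 :: "(real \<Rightarrow> real) \<Rightarrow> real \<Rightarrow> real" where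
  "omega2 f t =
     (SUP h\<in>{0<..<t}. SUP u\<in>{0..1 - 2 * h}. \<bar>f u - 2 * f (u + h) + f (u + 2 * h)\<bar>)"

end

theory Submission
  imports Defs "HOL-Computational_Algebra.Polynomial_Factorial" "HOL-Computational_Algebra.Field_as_Ring"
begin

text \<open>
  Exchanging one interpolation node changes the interpolant of the truncated power by a multiple
  of the node polynomial of the common nodes. Telescoping this over consecutive knots gives
  Marsden's identity, from which the B-splines sum to one, reproduce linear functions, and have
  positive variance at each interior point. Nonnegativity follows because the leading coefficients
  of the interpolants interlace from one degree to the next.

  For the lower estimate subtract the linear interpolant of \<open>f\<close> at \<open>0\<close> and \<open>1\<close>. The values at the
  Greville nodes then vanish at the end points and are almost fixed by a stochastic matrix, so a
  maximum principle with a concave quadratic barrier bounds them by the approximation error, and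
  the error bounds \<open>f\<close> itself. The upper estimate needs only that a function vanishing at both
  end points is bounded by its second modulus, with a constant depending on \<open>t\<close>.
\<close>

subsection \<open>Interpolation of truncated powers\<close>

definition node_poly :: "real multiset \<Rightarrow> real poly" where
  "node_poly Y = (\<Prod>y\<in>#Y. [:- y, 1:])"

lemma node_poly_empty [simp]: "node_poly {#} = 1"
  by (simp add: node_poly_def)

lemma node_poly_add [simp]: "node_poly (add_mset y Y) = [:- y, 1:] * node_poly Y"
  by (simp only: node_poly_def image_mset_add_mset prod_mset.add_mset)

lemma node_poly_union: "node_poly (Y + Z) = node_poly Y * node_poly Z"
  by (simp add: node_poly_def)

lemma node_poly_replicate: "node_poly (replicate_mset k v) = [:- v, 1:] ^ k"
  by (simp add: node_poly_def)

lemma node_poly_neq_0 [simp]: "node_poly Y \<noteq> 0"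
  by (auto simp: node_poly_def)

lemma degree_node_poly [simp]: "degree (node_poly Y) = size Y"
  by (induction Y) (simp_all add: degree_mult_eq del: mult_pCons_left)

lemma coeff_node_poly_size [simp]: "coeff (node_poly Y) (size Y) = 1"
proof (induction Y)
  case (add y Y)
  then show ?case
    using degree_node_poly[of Y] by (simp add: coeff_eq_0)
qed simp

lemma coeff_node_poly_sub_leading:
  "size Y = Suc m \<Longrightarrow> coeff (node_poly Y) m = - sum_mset Y"
proof (induction Y arbitrary: m)
  case (add y Y)
  show ?case
  proof (cases m)
    case 0
    with add.prems show ?thesis by simp
  next
    case (Suc m')
    then have m: "size Y = Suc m'" "coeff (node_poly Y) (Suc m') = 1"
      using add.prems coeff_node_poly_size[of Y] by auto
    with add.IH[OF m(1)] Suc show ?thesis by simp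
  qed
qed simp

lemma node_poly_root_iff: "poly (node_poly Y) y = 0 \<longleftrightarrow> y \<in># Y"
  by (induction Y) auto

lemma coprime_linear_powers:
  fixes a b :: real
  assumes "a \<noteq> b"
  shows "coprime ([:- a, 1:] ^ m) ([:- b, 1:] ^ n)"
proof -
  have "coprime [:- a, 1:] [:- b, 1:]"
  proof (rule coprimeI)
    fix c :: "real poly"
    assume "c dvd [:- a, 1:]" "c dvd [:- b, 1:]"
    then have "c dvd [:- a, 1:] - [:- b, 1:]" by (rule dvd_diff)
    also have "[:- a, 1:] - [:- b, 1:] = [:b - a:]" by simp
    finally show "is_unit c"
      by (rule dvd_unit_imp_unit) (use assms in \<open>simp add: is_unit_triv\<close>)
  qed
  then show ?thesis by simp
qed

lemma node_poly_eq_prod: "node_poly Y = (\<Prod>y\<in>set_mset Y. [:- y, 1:] ^ count Y y)"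
  by (simp add: node_poly_def image_prod_mset_multiplicity)

lemma coprime_node_poly:
  assumes "set_mset Y \<inter> set_mset Z = {}"
  shows "coprime (node_poly Y) (node_poly Z)"
  unfolding node_poly_eq_prod
  using assms by (intro prod_coprime_left prod_coprime_right coprime_linear_powers) auto

text \<open>Powers of distinct linear factors are pairwise coprime, so divisibility by their product
  can be tested one node at a time.\<close>

lemma node_poly_dvd_iff:
  "node_poly Y dvd p \<longleftrightarrow> (\<forall>y\<in>#Y. [:- y, 1:] ^ count Y y dvd p)"
proof
  assume "node_poly Y dvd p"
  then show "\<forall>y\<in>#Y. [:- y, 1:] ^ count Y y dvd p"
    unfolding node_poly_eq_prod by (meson dvd_prod_eqI dvd_trans finite_set_mset dvd_prodI)
next
  assume *: "\<forall>y\<in>#Y. [:- y, 1:] ^ count Y y dvd p"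
  have "(\<Prod>y\<in>A. [:- y, 1:] ^ count Y y) dvd p" if "A \<subseteq> set_mset Y" "finite A" for A
    using that(2,1)
  proof (induction A rule: finite_induct)
    case (insert a A)
    have "coprime ([:- a, 1:] ^ count Y a) (\<Prod>y\<in>A. [:- y, 1:] ^ count Y y)"
      using insert.hyps by (intro prod_coprime_right coprime_linear_powers) auto
    with insert * show ?case
      by (simp add: divides_mult del: mult_pCons_left)
  qed simp
  then show "node_poly Y dvd p"
    by (simp add: node_poly_eq_prod)
qed

text \<open>Induction on \<open>c\<close>: in characteristic zero, differentiation lowers the order
  of a root by exactly one. This turns Hermite conditions into divisibility.\<close>

lemma linear_power_dvd_iff_higher_pderiv:
  fixes p :: "real poly"
  shows "[:- y, 1:] ^ c dvd p \<longleftrightarrow> (\<forall>i<c. poly ((pderiv ^^ i) p) y = 0)"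
proof (induction c arbitrary: p)
  case (Suc c)
  have "[:- y, 1:] ^ Suc c dvd p \<longleftrightarrow> poly p y = 0 \<and> [:- y, 1:] ^ c dvd pderiv p"
  proof (cases "p = 0 \<or> poly p y \<noteq> 0")
    case True
    then show ?thesis
    proof
      assume "poly p y \<noteq> 0"
      then have "\<not> [:- y, 1:] ^ Suc c dvd p"
        by (metis dvd_mult_left poly_eq_0_iff_dvd power_Suc)
      with \<open>poly p y \<noteq> 0\<close> show ?thesis by simp
    qed simp
  next
    case False
    then have "pderiv p \<noteq> 0"
      using pderiv_iszero[of p] by auto
    with False show ?thesis
      using order_pderiv[of p y] by (auto simp: order_divides simp del: power_Suc)
  qed
  also have "\<dots> \<longleftrightarrow> (\<forall>i<Suc c. poly ((pderiv ^^ i) p) y = 0)"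
    unfolding Suc.IH less_Suc_eq_0_disj by (auto simp: funpow_swap1)
  finally show ?case .
qed simp

section \<open>Interpolants of the truncated power\<close>

definition low_nodes :: "real \<Rightarrow> real multiset \<Rightarrow> real multiset" where
  "low_nodes v Y = filter_mset (\<lambda>y. y < v) Y"

text \<open>Nodes equal to \<open>v\<close> count as high. In degree zero this gives the step
  function the value one at its jump, so the recursion in the degree can start there.\<close>

definition high_nodes :: "real \<Rightarrow> real multiset \<Rightarrow> real multiset" where
  "high_nodes v Y = filter_mset (\<lambda>y. v \<le> y) Y"

text \<open>
  Away from \<open>v\<close> the function \<open>y \<mapsto> trunc_power k (y - v)\<close> coincides locally with \<open>0\<close> or with
  \<open>(y - v) ^ k\<close>, so Hermite interpolation becomes a pair of divisibility conditions. These make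
  sense for arbitrary multiplicities, also at \<open>v\<close> itself.
\<close>

definition trunc_interpolates :: "nat \<Rightarrow> real \<Rightarrow> real multiset \<Rightarrow> real poly \<Rightarrow> bool" where
  "trunc_interpolates k v Y q \<longleftrightarrow>
     node_poly (low_nodes v Y) dvd q \<and> node_poly (high_nodes v Y) dvd q - [:- v, 1:] ^ k"

lemma node_poly_split: "node_poly (low_nodes v Y) * node_poly (high_nodes v Y) = node_poly Y"
  unfolding node_poly_union[symmetric] low_nodes_def high_nodes_def
  by (subst multiset_partition[of Y "\<lambda>y. y < v"]) (simp add: not_less)

lemma coprime_low_high: "coprime (node_poly (low_nodes v Y)) (node_poly (high_nodes v Y))"
  by (intro coprime_node_poly) (auto simp: low_nodes_def high_nodes_def)

lemma trunc_interpolates_diff: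
  assumes "trunc_interpolates k v Y q" "trunc_interpolates k v Y q'"
  shows "node_poly Y dvd q' - q"
proof -
  have "node_poly (low_nodes v Y) dvd q' - q"
    using assms by (auto simp: trunc_interpolates_def)
  moreover have "node_poly (high_nodes v Y) dvd (q' - [:- v, 1:] ^ k) - (q - [:- v, 1:] ^ k)"
    using assms unfolding trunc_interpolates_def by (blast intro: dvd_diff)
  ultimately show ?thesis
    using divides_mult[OF _ _ coprime_low_high[of v Y]] by (simp add: node_poly_split)
qed

lemma trunc_interpolates_subset:
  assumes "trunc_interpolates k v Y q" "Z \<subseteq># Y"
  shows "trunc_interpolates k v Z q"
proof -
  obtain W where "Y = Z + W"
    using assms(2) by (auto simp: subset_mset.le_iff_add)
  with assms(1) show ?thesis
    by (auto simp: trunc_interpolates_def low_nodes_def high_nodes_def node_poly_union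
        dest: dvd_mult_left)
qed

text \<open>Chinese remainder theorem for the coprime node polynomials of the low and the high
  nodes.\<close>

lemma trunc_interpolates_ex:
  assumes "Y \<noteq> {#}"
  shows "\<exists>q. degree q < size Y \<and> trunc_interpolates k v Y q"
proof -
  define L R :: "real poly" where "L = node_poly (low_nodes v Y)" and "R = node_poly (high_nodes v Y)"
  obtain a b where ab: "a * L + b * R = 1"
    using bezout_coefficients_fst_snd[of L R] coprime_low_high[of v Y]
    by (auto simp: L_def R_def)
  \<comment> \<open>By the Bezout identity \<open>a * L\<close> is zero modulo \<open>L\<close> and
    one modulo \<open>R\<close>; reduction modulo \<open>node_poly Y\<close> preserves both
    congruences and lowers the degree.\<close>
  define q where "q = (a * L * [:- v, 1:] ^ k) mod node_poly Y"
  have "node_poly Y dvd q - a * L * [:- v, 1:] ^ k"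
    unfolding q_def by (simp add: mod_eq_dvd_iff[symmetric])
  then have "L dvd q - a * L * [:- v, 1:] ^ k" "R dvd q - a * L * [:- v, 1:] ^ k"
    unfolding L_def R_def by (metis dvd_mult_left dvd_mult_right node_poly_split)+
  moreover have "L dvd a * L * [:- v, 1:] ^ k" by simp
  moreover have "R dvd a * L * [:- v, 1:] ^ k - [:- v, 1:] ^ k"
  proof -
    have "a * L * [:- v, 1:] ^ k - [:- v, 1:] ^ k = - (b * R * [:- v, 1:] ^ k)"
      using arg_cong[OF ab, of "\<lambda>p. p * [:- v, 1:] ^ k"]
      by (simp add: distrib_right diff_eq_eq add_eq_0_iff del: mult_pCons_left mult_pCons_right)
    then show ?thesis by simp
  qed
  ultimately have "L dvd q" "R dvd q - [:- v, 1:] ^ k"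
    using dvd_add[of L "q - a * L * [:- v, 1:] ^ k" "a * L * [:- v, 1:] ^ k"]
      dvd_add[of R "q - a * L * [:- v, 1:] ^ k" "a * L * [:- v, 1:] ^ k - [:- v, 1:] ^ k"]
    by (simp_all only: diff_add_cancel add_diff_eq)
  moreover have "degree q < size Y"
    using degree_mod_less[of "node_poly Y" "a * L * [:- v, 1:] ^ k"] assms
    by (auto simp: q_def nonempty_has_size)
  ultimately show ?thesis
    by (auto simp: trunc_interpolates_def L_def R_def)
qed

lemma dvd_degree_less_imp_0:
  fixes p q :: "real poly"
  assumes "p dvd q" "degree q < degree p"
  shows "q = 0"
  by (rule ccontr) (use assms dvd_imp_degree_le[of p q] in simp)

lemma trunc_interpolates_unique:
  assumes "trunc_interpolates k v Y q" "degree q < size Y"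
    and "trunc_interpolates k v Y q'" "degree q' < size Y"
  shows "q' = q"
proof -
  have "q' - q = 0"
    using trunc_interpolates_diff[OF assms(1,3)] degree_diff_less[OF assms(4,2)]
    by (intro dvd_degree_less_imp_0[of "node_poly Y"]) auto
  then show ?thesis by simp
qed

definition trunc_interpolant :: "nat \<Rightarrow> real \<Rightarrow> real multiset \<Rightarrow> real poly" where
  "trunc_interpolant k v Y = (THE q. degree q < size Y \<and> trunc_interpolates k v Y q)"

lemma trunc_interpolant_eqI:
  assumes "trunc_interpolates k v Y q" "degree q < size Y"
  shows "trunc_interpolant k v Y = q"
  unfolding trunc_interpolant_def
proof (rule the_equality)
  show "degree q < size Y \<and> trunc_interpolates k v Y q"
    using assms by simp
next
  fix q'
  assume "degree q' < size Y \<and> trunc_interpolates k v Y q'"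
  then show "q' = q"
    by (elim conjE) (rule trunc_interpolates_unique[OF assms])
qed

lemma trunc_interpolant:
  assumes "Y \<noteq> {#}"
  shows "degree (trunc_interpolant k v Y) < size Y" "trunc_interpolates k v Y (trunc_interpolant k v Y)"
proof -
  obtain q where q: "degree q < size Y" "trunc_interpolates k v Y q"
    using trunc_interpolates_ex[OF assms] by blast
  with trunc_interpolant_eqI[OF q(2,1)] show "degree (trunc_interpolant k v Y) < size Y"
    "trunc_interpolates k v Y (trunc_interpolant k v Y)"
    by simp_all
qed

section \<open>Divided differences of the truncated power\<close>

definition trunc_dd :: "nat \<Rightarrow> real \<Rightarrow> real multiset \<Rightarrow> real" where
  "trunc_dd k v Y = coeff (trunc_interpolant k v Y) (size Y - 1)"

text \<open>Newton's form. Both interpolants fit the data on \<open>Y\<close>, so they differ by a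
  multiple of the monic \<open>node_poly Y\<close>; the factor is the new top coefficient.\<close>

lemma trunc_interpolant_add:
  assumes "Y \<noteq> {#}"
  shows "trunc_interpolant k v (add_mset b Y) =
           trunc_interpolant k v Y + smult (trunc_dd k v (add_mset b Y)) (node_poly Y)"
proof -
  let ?q = "trunc_interpolant k v Y" and ?q' = "trunc_interpolant k v (add_mset b Y)"
  let ?c = "trunc_dd k v (add_mset b Y)"
  have q: "degree ?q < size Y" "trunc_interpolates k v Y ?q"
    using trunc_interpolant[OF assms] by auto
  have q': "degree ?q' \<le> size Y" "trunc_interpolates k v Y ?q'"
    using trunc_interpolant[of "add_mset b Y" k v]
      trunc_interpolates_subset[of k v "add_mset b Y" ?q' Y] by simp_all
  have "node_poly Y dvd ?q' - ?q - smult ?c (node_poly Y)"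
    by (intro dvd_diff trunc_interpolates_diff[OF q(2) q'(2)] dvd_smult dvd_refl)
  moreover have "degree (?q' - ?q - smult ?c (node_poly Y)) < size Y"
  proof -
    have "coeff (?q' - ?q - smult ?c (node_poly Y)) (size Y) = 0"
      using q(1) by (simp add: trunc_dd_def coeff_eq_0)
    moreover have "degree (?q' - ?q - smult ?c (node_poly Y)) \<le> size Y"
      using q(1) q'(1) by (intro degree_diff_le) auto
    ultimately show ?thesis
      using assms by (metis degree_0 leading_coeff_0_iff le_neq_implies_less nonempty_has_size)
  qed
  ultimately have "?q' - ?q - smult ?c (node_poly Y) = 0"
    by (intro dvd_degree_less_imp_0[of "node_poly Y"]) auto
  then show ?thesis by (simp add: algebra_simps)
qed

text \<open>Adding the missing node on either side leads to the same interpolant. Comparing the two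
  Newton forms leaves a difference of two node polynomials, which is \<open>b - a\<close> times that
  of \<open>M\<close>.\<close>

lemma trunc_interpolant_exchange:
  "trunc_interpolant k v (add_mset b M) - trunc_interpolant k v (add_mset a M) =
     smult ((b - a) * trunc_dd k v (add_mset a (add_mset b M))) (node_poly M)"
proof -
  define c where "c = trunc_dd k v (add_mset a (add_mset b M))"
  have "trunc_interpolant k v (add_mset b M) + smult c (node_poly (add_mset b M)) =
        trunc_interpolant k v (add_mset a M) + smult c (node_poly (add_mset a M))"
    using trunc_interpolant_add[of "add_mset b M" k v a] trunc_interpolant_add[of "add_mset a M" k v b]
    by (simp add: c_def add_mset_commute)
  then have "trunc_interpolant k v (add_mset b M) - trunc_interpolant k v (add_mset a M) =
        smult c (node_poly (add_mset a M) - node_poly (add_mset b M))"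
    by (simp add: algebra_simps smult_diff_right)
  also have "node_poly (add_mset a M) - node_poly (add_mset b M) = smult (b - a) (node_poly M)"
    by (simp add: algebra_simps smult_diff_left)
  finally show ?thesis by (simp add: c_def mult.commute)
qed

text \<open>The recursion for divided differences, cleared of denominators so that it also covers
  \<open>a = b\<close>.\<close>

lemma trunc_dd_exchange:
  "trunc_dd k v (add_mset b M) - trunc_dd k v (add_mset a M) =
     (b - a) * trunc_dd k v (add_mset a (add_mset b M))"
  using arg_cong[OF trunc_interpolant_exchange[of k v b M a], of "\<lambda>p. coeff p (size M)"]
  by (simp add: trunc_dd_def)

text \<open>
  The factorization \<open>(y - v)\<^sub>+\<^sup>k\<^sup>+\<^sup>1 = (y - v) (y - v)\<^sub>+\<^sup>k\<close> underlies the
  recursion in the degree.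
\<close>

lemma trunc_interpolant_Suc:
  assumes "Y \<noteq> {#}"
  shows "trunc_interpolant (Suc k) v Y =
           [:- v, 1:] * trunc_interpolant k v Y - smult (trunc_dd k v Y) (node_poly Y)"
proof (rule trunc_interpolant_eqI)
  let ?r = "trunc_interpolant k v Y"
  let ?q = "[:- v, 1:] * ?r - smult (trunc_dd k v Y) (node_poly Y)"
  have r: "degree ?r < size Y" "trunc_interpolates k v Y ?r"
    using trunc_interpolant[OF assms] by auto
  have *: "node_poly (low_nodes v Y) dvd node_poly Y" "node_poly (high_nodes v Y) dvd node_poly Y"
    using node_poly_split[of v Y] by (metis dvd_triv_left dvd_triv_right)+
  have "node_poly (low_nodes v Y) dvd ?q"
    using r(2) * by (intro dvd_diff dvd_mult dvd_smult) (auto simp: trunc_interpolates_def)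
  moreover have "?q - [:- v, 1:] ^ Suc k =
      [:- v, 1:] * (?r - [:- v, 1:] ^ k) - smult (trunc_dd k v Y) (node_poly Y)"
    by (simp add: algebra_simps del: mult_pCons_left)
  then have "node_poly (high_nodes v Y) dvd ?q - [:- v, 1:] ^ Suc k"
    using r(2) * unfolding trunc_interpolates_def
    by (metis dvd_diff dvd_mult dvd_smult)
  ultimately show "trunc_interpolates (Suc k) v Y ?q"
    by (simp add: trunc_interpolates_def)
  obtain m where m: "size Y = Suc m"
    using assms by (metis not0_implies_Suc size_eq_0_iff_empty)
  have "degree ([:- v, 1:] * ?r) \<le> size Y"
    using r(1) degree_mult_le[of "[:- v, 1:]" ?r] by simp
  then have "degree ?q \<le> size Y"
    by (intro degree_diff_le) auto
  \<comment> \<open>Both terms of \<open>?q\<close> have the coefficient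
    \<open>trunc_dd k v Y\<close> here, since \<open>node_poly Y\<close> is monic; they
    cancel.\<close>
  moreover have "coeff ?q (size Y) = 0"
    using coeff_node_poly_size[of Y] r(1) m by (simp add: trunc_dd_def coeff_eq_0)
  ultimately show "degree ?q < size Y"
    using assms by (metis degree_0 leading_coeff_0_iff le_neq_implies_less nonempty_has_size)
qed

text \<open>Leibniz rule for the divided difference of a product; the factor \<open>y - v\<close> is
  linear, so only two terms survive.\<close>

lemma trunc_dd_Suc:
  assumes "Z \<noteq> {#}"
  shows "trunc_dd (Suc k) v (add_mset b Z) =
           trunc_dd k v Z + (b - v) * trunc_dd k v (add_mset b Z)"
proof -
  define c where "c = trunc_dd k v (add_mset b Z)"
  obtain m where m: "size Z = Suc m"
    using assms by (metis not0_implies_Suc size_eq_0_iff_empty)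
  have "trunc_interpolant (Suc k) v (add_mset b Z) =
      [:- v, 1:] * (trunc_interpolant k v Z + smult c (node_poly Z)) - smult c ([:- b, 1:] * node_poly Z)"
    using trunc_interpolant_Suc[of "add_mset b Z" k v] trunc_interpolant_add[OF assms, of k v b]
    by (simp add: c_def del: mult_pCons_left)
  also have "\<dots> = [:- v, 1:] * trunc_interpolant k v Z + smult (c * (b - v)) (node_poly Z)"
    by (intro poly_eqI) (simp add: coeff_pCons algebra_simps split: nat.split)
  finally show ?thesis
    using trunc_interpolant[OF assms, of k v] m coeff_node_poly_size[of Z]
    by (simp add: trunc_dd_def c_def coeff_eq_0 mult.commute)
qed

lemma trunc_interpolant_high:
  assumes "size Y = Suc k" "\<And>y. y \<in># Y \<Longrightarrow> v \<le> y"
  shows "trunc_interpolant k v Y = [:- v, 1:] ^ k"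
proof (rule trunc_interpolant_eqI)
  have "low_nodes v Y = {#}"
    using assms(2) by (fastforce simp: low_nodes_def simp flip: set_mset_eq_empty_iff)
  then show "trunc_interpolates k v Y ([:- v, 1:] ^ k)"
    by (simp add: trunc_interpolates_def)
qed (use assms in \<open>simp add: degree_linear_power\<close>)

lemma trunc_interpolant_low:
  assumes "Y \<noteq> {#}" "\<And>y. y \<in># Y \<Longrightarrow> y < v"
  shows "trunc_interpolant k v Y = 0"
proof (rule trunc_interpolant_eqI)
  have "high_nodes v Y = {#}"
    using assms(2) by (fastforce simp: high_nodes_def simp flip: set_mset_eq_empty_iff)
  then show "trunc_interpolates k v Y 0"
    by (simp add: trunc_interpolates_def)
qed (use assms in \<open>simp add: nonempty_has_size\<close>)

lemma trunc_dd_high: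
  assumes "size Y = Suc k" "\<And>y. y \<in># Y \<Longrightarrow> v \<le> y"
  shows "trunc_dd k v Y = 1"
proof -
  have "coeff ([:- v, 1:] ^ k) k = 1"
    using coeff_node_poly_size[of "replicate_mset k v"] by (simp add: node_poly_replicate)
  then show ?thesis
    using trunc_interpolant_high[OF assms] assms(1) by (simp add: trunc_dd_def)
qed

lemma trunc_dd_low:
  assumes "Y \<noteq> {#}" "\<And>y. y \<in># Y \<Longrightarrow> y < v"
  shows "trunc_dd k v Y = 0"
  by (simp add: trunc_dd_def trunc_interpolant_low[OF assms])

section \<open>Agreement with Hermite interpolation\<close>

lemma trunc_interpolates_iff:
  "trunc_interpolates k v Y p \<longleftrightarrow>
     (\<forall>y\<in>#Y. [:- y, 1:] ^ count Y y dvd p - (if y < v then 0 else [:- v, 1:] ^ k))"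
  unfolding trunc_interpolates_def node_poly_dvd_iff
  by (auto simp: low_nodes_def high_nodes_def not_less)

lemma higher_deriv_poly: "(deriv ^^ i) (poly p) = poly ((pderiv ^^ i) p)"
  for p :: "real poly"
proof (induction i)
  case (Suc i)
  then show ?case
    by (auto intro!: DERIV_imp_deriv poly_DERIV)
qed simp

lemma higher_pderiv_diff: "(pderiv ^^ i) (p - q) = (pderiv ^^ i) p - (pderiv ^^ i) q"
  for p q :: "real poly"
  by (induction i) (simp_all add: pderiv_diff)

text \<open>Away from \<open>v\<close> the truncated power is locally a polynomial, so all
  derivatives can be compared. At \<open>v\<close> the multiplicity bound leaves only the value,
  which is zero on both sides because \<open>k > 0\<close>.\<close>

lemma hermite_interpolates_trunc_power_iff:
  assumes "k > 0" "count_list ys v \<le> 1"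
  shows "hermite_interpolates p (\<lambda>y. trunc_power k (y - v)) ys \<longleftrightarrow>
           trunc_interpolates k v (mset ys) p"
proof -
  define G :: "real \<Rightarrow> real poly" where "G y = (if y < v then 0 else [:- v, 1:] ^ k)" for y
  have "(\<forall>i<count_list ys y. poly ((pderiv ^^ i) p) y =
            (deriv ^^ i) (\<lambda>y. trunc_power k (y - v)) y) \<longleftrightarrow>
          [:- y, 1:] ^ count (mset ys) y dvd p - G y" if "y \<in> set ys" for y
  proof (cases "y = v")
    case True
    have "count_list ys y = 1"
      using assms(2) that True count_list_0_iff[of ys v] by (cases "count_list ys v") auto
    then show ?thesis
      using True assms(1)
      by (simp add: count_mset G_def trunc_power_def zero_power poly_eq_0_iff_dvd[symmetric]
          del: power_Suc)
  next
    case False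
    have "eventually (\<lambda>z. trunc_power k (z - v) = poly (G y) z) (nhds y)"
    proof (cases "y < v")
      case True
      then have "eventually (\<lambda>z. z < v) (nhds y)"
        by (intro eventually_nhds_in_open[of "{..<v}" y, simplified]) auto
      then show ?thesis
        by eventually_elim (use True in \<open>simp add: trunc_power_def G_def\<close>)
    next
      case less: False
      then have "eventually (\<lambda>z. v < z) (nhds y)"
        using False by (intro eventually_nhds_in_open[of "{v<..}" y, simplified]) auto
      then show ?thesis
        by eventually_elim (use less in \<open>simp add: trunc_power_def G_def\<close>)
    qed
    then have "(deriv ^^ i) (\<lambda>y. trunc_power k (y - v)) y = poly ((pderiv ^^ i) (G y)) y" for i
      using higher_deriv_cong_ev[of _ "poly (G y)" y y i] by (simp add: higher_deriv_poly)
    then show ?thesis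
      by (simp add: count_mset linear_power_dvd_iff_higher_pderiv higher_pderiv_diff)
  qed
  then show ?thesis
    by (simp add: hermite_interpolates_def trunc_interpolates_iff G_def)
qed

lemma divided_difference_trunc_power:
  assumes "k > 0" "ys \<noteq> []" "count_list ys v \<le> 1"
  shows "divided_difference ys (\<lambda>y. trunc_power k (y - v)) = trunc_dd k v (mset ys)"
proof -
  have "degree p \<le> length ys - 1 \<longleftrightarrow> degree p < size (mset ys)" for p :: "real poly"
    using assms(2) by (cases ys) auto
  then show ?thesis
    using assms
    by (simp add: divided_difference_def hermite_interpolates_trunc_power_iff trunc_dd_def
        trunc_interpolant_def)
qed

subsection \<open>Weights of the B-splines\<close>

definition nodes :: "(int \<Rightarrow> real) \<Rightarrow> int \<Rightarrow> nat \<Rightarrow> real multiset" where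
  "nodes x j m = image_mset x (mset_set {j..<j + int m})"

lemma size_nodes [simp]: "size (nodes x j m) = m"
  by (simp add: nodes_def)

lemma set_nodes [simp]: "set_mset (nodes x j m) = x ` {j..<j + int m}"
  by (simp add: nodes_def)

lemma nodes_Suc: "nodes x j (Suc m) = add_mset (x j) (nodes x (j + 1) m)"
proof -
  have "{j..<j + int (Suc m)} = insert j {j + 1..<j + 1 + int m}" by auto
  then show ?thesis by (simp add: nodes_def)
qed

lemma nodes_Suc': "nodes x j (Suc m) = add_mset (x (j + int m)) (nodes x j m)"
proof -
  have "{j..<j + int (Suc m)} = insert (j + int m) {j..<j + int m}" by auto
  then show ?thesis by (simp add: nodes_def)
qed

lemma mset_map_upto: "mset (map x [j..j + int m]) = nodes x j (Suc m)"
proof -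
  have "mset [j..j + int m] = mset_set {j..<j + int (Suc m)}"
    by (subst mset_set_set[symmetric]) (auto intro!: arg_cong[of _ _ mset_set])
  then show ?thesis by (simp add: nodes_def)
qed

text \<open>
  On the open interval the B-splines are the increments of this distribution function in \<open>j\<close>.
\<close>

definition cum :: "(int \<Rightarrow> real) \<Rightarrow> real \<Rightarrow> nat \<Rightarrow> int \<Rightarrow> real" where
  "cum x v m j = trunc_dd m v (nodes x j (Suc m))"

lemma cum_high:
  assumes "mono x" "v \<le> x j"
  shows "cum x v m j = 1"
  unfolding cum_def
proof (rule trunc_dd_high)
  fix y assume "y \<in># nodes x j (Suc m)"
  then obtain i where "j \<le> i" "y = x i" by auto
  then show "v \<le> y"
    using assms by (meson order_trans monoD)
qed simp

lemma cum_low: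
  assumes "mono x" "x (j + int m) < v"
  shows "cum x v m j = 0"
  unfolding cum_def
proof (rule trunc_dd_low)
  fix y assume "y \<in># nodes x j (Suc m)"
  then obtain i where "i \<in> {j..<j + int (Suc m)}" "y = x i"
    unfolding set_nodes by blast
  then have "i \<le> j + int m" "y = x i" by auto
  then show "y < v"
    using assms by (meson le_less_trans monoD)
qed (simp add: nodes_Suc)

text \<open>Moving the window by one exchanges its first knot for the next one on the right, so the
  increment has the form of a normalized B-spline.\<close>

lemma cum_diff:
  "cum x v m (j + 1) - cum x v m j =
     (x (j + int m + 1) - x j) * trunc_dd m v (nodes x j (Suc (Suc m)))"
  using trunc_dd_exchange[of m v "x (j + int m + 1)" "nodes x (j + 1) m" "x j"]
  by (simp add: cum_def nodes_Suc[of x j] nodes_Suc'[of x "j + 1"] add.assoc add.commute[of 1])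

lemma cum_Suc:
  "cum x v (Suc m) j =
     cum x v m j + (x (j + int m + 1) - v) * trunc_dd m v (nodes x j (Suc (Suc m)))"
  using trunc_dd_Suc[of "nodes x j (Suc m)" m v "x (j + int m + 1)"]
  by (simp add: cum_def nodes_Suc'[of x j "Suc m"] nodes_Suc[of x j m] ac_simps)

text \<open>Cox-de Boor recursion in cumulative form: eliminating the divided difference between
  \<open>cum_Suc\<close> and \<open>cum_diff\<close> leaves a convex combination of two neighbours
  of lower degree.\<close>

lemma cum_Suc_convex:
  assumes "x j < v" "v \<le> x (j + int m + 1)"
  shows "cum x v (Suc m) j = cum x v m j +
           (x (j + int m + 1) - v) / (x (j + int m + 1) - x j) * (cum x v m (j + 1) - cum x v m j)"
  using assms by (simp add: cum_Suc cum_diff)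

text \<open>If \<open>v\<close> is at most the first knot all three values are one, and beyond the
  last knot all are zero; in between the convex recursion applies.\<close>

lemma cum_interlace:
  assumes "mono x" "cum x v m j \<le> cum x v m (j + 1)"
  shows "cum x v m j \<le> cum x v (Suc m) j" "cum x v (Suc m) j \<le> cum x v m (j + 1)"
proof -
  consider "v \<le> x j" | "x (j + int m + 1) < v" | "x j < v" "v \<le> x (j + int m + 1)"
    by linarith
  then have "cum x v m j \<le> cum x v (Suc m) j \<and> cum x v (Suc m) j \<le> cum x v m (j + 1)"
  proof cases
    case 1
    moreover have "x j \<le> x (j + 1)"
      using assms(1) by (simp add: monoD)
    ultimately show ?thesis
      using assms(1) by (simp add: cum_high)
  next
    case 2
    moreover have "x (j + int m) \<le> x (j + int m + 1)"
      using assms(1) by (simp add: monoD)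
    ultimately show ?thesis
      using assms(1) cum_low[of x j m v] cum_low[of x "j + 1" m v] cum_low[of x j "Suc m" v]
      by (simp add: ac_simps)
  next
    case 3
    define s where "s = (x (j + int m + 1) - v) / (x (j + int m + 1) - x j)"
    have "0 \<le> s" "s \<le> 1"
      using 3 by (auto simp: s_def divide_simps)
    then have "0 \<le> s * (cum x v m (j + 1) - cum x v m j)"
      "s * (cum x v m (j + 1) - cum x v m j) \<le> 1 * (cum x v m (j + 1) - cum x v m j)"
      using assms(2) by (simp, intro mult_right_mono) auto
    then show ?thesis
      using cum_Suc_convex[OF 3] by (simp add: s_def)
  qed
  then show "cum x v m j \<le> cum x v (Suc m) j" "cum x v (Suc m) j \<le> cum x v m (j + 1)"
    by auto
qed

text \<open>Nonnegativity of the B-splines. By interlacing, the degree \<open>m\<close> value at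
  \<open>j + 1\<close> separates the degree \<open>Suc m\<close> values at \<open>j\<close> and
  \<open>j + 1\<close>.\<close>

lemma cum_mono:
  assumes "mono x"
  shows "cum x v m j \<le> cum x v m (j + 1)"
proof (induction m arbitrary: j)
  case 0
  have "x j \<le> x (j + 1)"
    using assms by (simp add: monoD)
  then show ?case
    using cum_high[OF assms, of v j 0] cum_low[OF assms, of j 0 v]
      cum_high[OF assms, of v "j + 1" 0] cum_low[OF assms, of "j + 1" 0 v]
    by (cases "v \<le> x j"; cases "v \<le> x (j + 1)") auto
next
  case (Suc m)
  show ?case
    using cum_interlace(2)[OF assms Suc[of j]] cum_interlace(1)[OF assms Suc[of "j + 1"]]
    by linarith
qed

text \<open>The dichotomy puts \<open>v\<close> eventually on one side of every knot, so a single
  branch of the recursion applies along \<open>F\<close>. It is made for one-sided limits.\<close>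

lemma cum_limit:
  assumes "mono x" "((\<lambda>v. v) \<longlongrightarrow> p) F"
    and dichotomy: "\<And>c. eventually (\<lambda>v. v \<le> c) F \<or> eventually (\<lambda>v. c < v) F"
  shows "\<exists>l. ((\<lambda>v. cum x v m j) \<longlongrightarrow> l) F"
proof -
  have high: "\<exists>l. ((\<lambda>v. cum x v m j) \<longlongrightarrow> l) F" if "eventually (\<lambda>v. v \<le> x j) F" for m j
    using tendsto_eventually[OF eventually_mono[OF that], of "\<lambda>v. cum x v m j" 1]
      cum_high[OF assms(1)] by blast
  have low: "\<exists>l. ((\<lambda>v. cum x v m j) \<longlongrightarrow> l) F" if "eventually (\<lambda>v. x (j + int m) < v) F" for m j
    using tendsto_eventually[OF eventually_mono[OF that], of "\<lambda>v. cum x v m j" 0]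
      cum_low[OF assms(1)] by blast
  show ?thesis
  proof (induction m arbitrary: j)
    case 0
    show ?case
      using dichotomy[of "x j"] high[of j 0] low[of j 0] by auto
  next
    case (Suc m)
    let ?b = "x (j + int m + 1)"
    have "j + int (Suc m) = j + int m + 1" by simp
    then consider "eventually (\<lambda>v. v \<le> x j) F" | "eventually (\<lambda>v. x (j + int (Suc m)) < v) F"
      | "eventually (\<lambda>v. x j < v) F" "eventually (\<lambda>v. v \<le> ?b) F"
      using dichotomy by metis
    then show ?case
    proof cases
      case 3
      obtain l l' where l: "((\<lambda>v. cum x v m j) \<longlongrightarrow> l) F"
        "((\<lambda>v. cum x v m (j + 1)) \<longlongrightarrow> l') F"
        using Suc by blast
      have "eventually (\<lambda>v. cum x v m j + (?b - v) / (?b - x j) * (cum x v m (j + 1) - cum x v m j)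
          = cum x v (Suc m) j) F"
        using 3 by eventually_elim (simp add: cum_Suc_convex)
      moreover have "((\<lambda>v. cum x v m j + (?b - v) / (?b - x j) * (cum x v m (j + 1) - cum x v m j))
          \<longlongrightarrow> l + (?b - p) * inverse (?b - x j) * (l' - l)) F"
        unfolding divide_inverse by (intro tendsto_intros l assms(2))
      ultimately have "((\<lambda>v. cum x v (Suc m) j) \<longlongrightarrow>
          l + (?b - p) * inverse (?b - x j) * (l' - l)) F"
        by (rule Lim_transform_eventually[rotated])
      then show ?thesis by (rule exI)
    qed (fact high low)+
  qed
qed

section \<open>B-spline values as weights at interior points\<close>

definition weight :: "(int \<Rightarrow> real) \<Rightarrow> nat \<Rightarrow> real \<Rightarrow> int \<Rightarrow> real" where
  "weight x k v j = cum x v k (j + 1) - cum x v k j"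

lemma weight_nonneg: "mono x \<Longrightarrow> 0 \<le> weight x k v j"
  using cum_mono by (simp add: weight_def)

lemma knot_zero: "knot_sequence n k x \<Longrightarrow> - int k \<le> j \<Longrightarrow> j \<le> 0 \<Longrightarrow> x j = 0"
  and knot_one: "knot_sequence n k x \<Longrightarrow> int n \<le> j \<Longrightarrow> j \<le> int n + int k \<Longrightarrow> x j = 1"
  and knot_step: "knot_sequence n k x \<Longrightarrow> 0 \<le> j \<Longrightarrow> j < int n \<Longrightarrow> x j < x (j + 1)"
  by (auto simp: knot_sequence_def)

lemma knot_strict:
  assumes "knot_sequence n k x" "mono x" "0 \<le> i" "i < int n" "i < j"
  shows "x i < x j"
  using knot_step[OF assms(1,3,4)] monoD[OF assms(2), of "i + 1" j] assms(5) by simp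

text \<open>Monotonicity keeps knots of index at most \<open>0\<close> below \<open>v\<close> and
  those of index at least \<open>n\<close> above it; between them the knots increase strictly. This
  supplies the multiplicity bound of the Hermite comparison.\<close>

lemma knot_simple:
  assumes "knot_sequence n k x" "mono x" "x i = v" "x j = v" "0 < v" "v < 1"
  shows "i = j"
proof -
  have *: "0 \<le> l \<and> l < int n" if "x l = v" for l
  proof (rule ccontr)
    assume "\<not> (0 \<le> l \<and> l < int n)"
    then consider "l \<le> 0" | "int n \<le> l" by linarith
    then show False
    proof cases
      case 1
      then show False
        using monoD[OF assms(2) 1] knot_zero[OF assms(1), of 0] that assms(5) by simp
    next
      case 2
      then show False
        using monoD[OF assms(2) 2] knot_one[OF assms(1), of n] that assms(6) by simp
    qed
  qed
  show ?thesis
    using knot_strict[OF assms(1,2), of i j] knot_strict[OF assms(1,2), of j i] *[of i] *[of j] assms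
    by (cases i j rule: linorder_cases) auto
qed

lemma count_list_map_le_1:
  assumes "distinct L" "\<And>i j. f i = v \<Longrightarrow> f j = v \<Longrightarrow> i = j"
  shows "count_list (map f L) v \<le> 1"
  using assms(1)
proof (induction L)
  case (Cons a L)
  show ?case
  proof (cases "f a = v")
    case True
    then have "v \<notin> set (map f L)"
      using Cons.prems assms(2)[of a] by fastforce
    then show ?thesis
      using True by (simp del: set_map)
  qed (use Cons in simp)
qed simp

text \<open>Stated for the bare expression rather than for \<open>bspline\<close>, since at
  \<open>0\<close> the latter is the limit of this very expression.\<close>

lemma bspline_eq_weight:
  assumes "knot_sequence n k x" "mono x" "k > 0" "0 < v" "v < 1"
  shows "(x (j + int k + 1) - x j) *
      divided_difference (map x [j..j + int k + 1]) (\<lambda>y. trunc_power k (y - v)) = weight x k v j"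
proof -
  have eq: "j + int k + 1 = j + int (Suc k)" by simp
  have "count_list (map x [j..j + int (Suc k)]) v \<le> 1"
    using knot_simple[OF assms(1,2) _ _ assms(4,5)] by (intro count_list_map_le_1) auto
  then have "divided_difference (map x [j..j + int (Suc k)]) (\<lambda>y. trunc_power k (y - v)) =
      trunc_dd k v (nodes x j (Suc (Suc k)))"
    unfolding mset_map_upto[symmetric] using assms(3)
    by (intro divided_difference_trunc_power) auto
  then show ?thesis
    unfolding weight_def cum_diff eq by simp
qed

section \<open>Marsden's identity and the moments of the weights\<close>

lemma sum_telescope_int:
  fixes f :: "int \<Rightarrow> 'a::ab_group_add"
  assumes "a \<le> b"
  shows "(\<Sum>j=a..b - 1. f (j + 1) - f j) = f b - f a"
  using assms
proof (induction b rule: int_ge_induct)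
  case (step b)
  then have "{a..b + 1 - 1} = insert b {a..b - 1}" by auto
  with step show ?case by simp
qed simp

text \<open>The summands are differences of interpolants over consecutive windows. The first window
  consists of zeros, which lie below \<open>v\<close>, and its interpolant is zero; the last
  consists of ones, and its interpolant is the full power.\<close>

lemma marsden_identity:
  assumes "knot_sequence n k x" "mono x" "0 < v" "v < 1"
  shows "(\<Sum>j=- int k..int n - 1. smult (weight x k v j) (node_poly (nodes x (j + 1) k))) =
           [:- v, 1:] ^ k"
proof -
  define F where "F j = trunc_interpolant k v (nodes x j (Suc k))" for j
  have "smult (weight x k v j) (node_poly (nodes x (j + 1) k)) = F (j + 1) - F j" for j
    using trunc_interpolant_exchange[of k v "x (j + int k + 1)" "nodes x (j + 1) k" "x j"]
    unfolding weight_def cum_diff F_def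
    by (simp add: nodes_Suc[of x j] nodes_Suc'[of x "j + 1"] add.assoc add.commute[of 1])
  then have "(\<Sum>j=- int k..int n - 1. smult (weight x k v j) (node_poly (nodes x (j + 1) k))) =
      F (int n) - F (- int k)"
    using sum_telescope_int[of "- int k" "int n" F] by simp
  moreover have "F (int n) = [:- v, 1:] ^ k"
    unfolding F_def using assms by (intro trunc_interpolant_high) (auto simp: knot_one)
  moreover have "F (- int k) = 0"
    unfolding F_def
    using assms by (intro trunc_interpolant_low) (auto simp: knot_zero nodes_Suc)
  ultimately show ?thesis by simp
qed

text \<open>Coefficient of degree \<open>k\<close> in Marsden's identity, where all polynomials
  involved are monic.\<close>

lemma sum_weight:
  assumes "knot_sequence n k x" "mono x" "0 < v" "v < 1"
  shows "(\<Sum>j=- int k..int n - 1. weight x k v j) = 1"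
proof -
  have *: "coeff (node_poly (nodes x j k)) k = 1" "coeff ([:- v, 1:] ^ k) k = 1" for j
    using coeff_node_poly_size[of "nodes x j k"] coeff_node_poly_size[of "replicate_mset k v"]
    by (simp_all add: node_poly_replicate)
  show ?thesis
    using arg_cong[OF marsden_identity[OF assms], of "\<lambda>p. coeff p k"] by (simp add: coeff_sum *)
qed

lemma greville_eq: "greville x j k = sum_mset (nodes x (j + 1) k) / real k"
proof -
  have "{j + 1..j + int k} = {j + 1..<j + 1 + int k}" by auto
  then show ?thesis
    by (simp add: greville_def nodes_def sum_unfold_sum_mset)
qed

text \<open>Coefficient of degree \<open>k - 1\<close> in Marsden's identity: by Vieta each node
  polynomial contributes minus the sum of its knots, which is \<open>- k\<close> times a Greville
  node.\<close>

lemma sum_greville_weight: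
  assumes "knot_sequence n k x" "mono x" "k > 0" "0 < v" "v < 1"
  shows "(\<Sum>j=- int k..int n - 1. greville x j k * weight x k v j) = v"
proof -
  obtain m where m: "k = Suc m"
    using assms(3) by (cases k) auto
  have *: "coeff (node_poly (nodes x (j + 1) k)) m = - (real k * greville x j k)" for j
    using coeff_node_poly_sub_leading[of "nodes x (j + 1) k" m] assms(3) m
    by (simp add: greville_eq)
  have **: "coeff ([:- v, 1:] ^ k) m = - (real k * v)"
    using coeff_node_poly_sub_leading[of "replicate_mset k v" m] m
    by (simp only: node_poly_replicate sum_mset_replicate_mset size_replicate_mset)
  have "(\<Sum>j=- int k..int n - 1. weight x k v j * (real k * greville x j k)) = real k * v"
    using arg_cong[OF marsden_identity[OF assms(1,2,4,5)], of "\<lambda>p. coeff p m"]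
    by (simp add: coeff_sum * ** sum_negf)
  then have "real k * (\<Sum>j=- int k..int n - 1. greville x j k * weight x k v j) = real k * v"
    by (simp add: sum_distrib_left mult_ac)
  with assms(3) show ?thesis by simp
qed

lemma greville_strict_mono:
  assumes "knot_sequence n k x" "mono x" "k > 0" "- int k \<le> i" "i < j" "j \<le> int n - 1"
  shows "greville x i k < greville x j k"
proof -
  have shift: "(\<Sum>l=j + 1..j + int k. x l) = (\<Sum>l=1..int k. x (j + l))" for j
    by (rule sum.reindex_bij_witness[of _ "\<lambda>l. j + l" "\<lambda>l. l - j"]) auto
  have "n > 0"
    using knot_zero[OF assms(1), of 0] knot_one[OF assms(1), of 0] by (cases n) auto
  \<comment> \<open>With this \<open>l\<close> the index \<open>i + l\<close> equals
    \<open>max (i + 1) 0\<close>, which lies in the range where the knots increase strictly.\<close>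
  define l where "l = max 1 (- i)"
  have "x (i + l) < x (j + l)"
    using assms \<open>n > 0\<close> by (intro knot_strict) (auto simp: l_def max_def)
  moreover have "l \<in> {1..int k}"
    using assms by (auto simp: l_def)
  ultimately have "(\<Sum>l=1..int k. x (i + l)) < (\<Sum>l=1..int k. x (j + l))"
    using assms(2,5) by (intro sum_strict_mono_ex1) (auto simp: monoD)
  then show ?thesis
    using assms(3) by (simp add: greville_def shift divide_strict_right_mono)
qed

text \<open>If the variance vanished, distinctness of the Greville nodes would put all weight on one
  index. Marsden's identity would then make the \<open>k \<ge> 2\<close> knots of that index all
  equal to \<open>v\<close>, but interior knots are simple.\<close>

lemma variance_weight_pos:
  assumes "knot_sequence n k x" "mono x" "k \<ge> 2" "0 < v" "v < 1"
  shows "0 < (\<Sum>j=- int k..int n - 1. (greville x j k - v)\<^sup>2 * weight x k v j)"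
proof (rule ccontr)
  let ?J = "{- int k..int n - 1}"
  assume "\<not> 0 < (\<Sum>j\<in>?J. (greville x j k - v)\<^sup>2 * weight x k v j)"
  moreover have nonneg: "0 \<le> (greville x j k - v)\<^sup>2 * weight x k v j" for j
    using weight_nonneg[OF assms(2)] by simp
  ultimately have "(\<Sum>j\<in>?J. (greville x j k - v)\<^sup>2 * weight x k v j) = 0"
    by (meson antisym_conv2 not_less sum_nonneg)
  then have *: "weight x k v j = 0 \<or> greville x j k = v" if "j \<in> ?J" for j
    using that nonneg by (subst (asm) sum_nonneg_eq_0_iff) auto
  obtain i where i: "i \<in> ?J" "weight x k v i \<noteq> 0"
    using sum_weight[OF assms(1,2,4,5)] by (metis (no_types, lifting) sum.neutral zero_neq_one)
  have other: "weight x k v j = 0" if "j \<in> ?J - {i}" for j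
    using *[OF i(1)] *[of j] i that assms
      greville_strict_mono[OF assms(1,2), of i j] greville_strict_mono[OF assms(1,2), of j i]
    by (cases i j rule: linorder_cases) auto
  have "weight x k v i = 1"
    using sum_weight[OF assms(1,2,4,5)] sum.remove[OF _ i(1), of "weight x k v"] other by simp
  then have eq: "node_poly (nodes x (i + 1) k) = [:- v, 1:] ^ k"
    using marsden_identity[OF assms(1,2,4,5)] other
      sum.remove[OF _ i(1), of "\<lambda>j. smult (weight x k v j) (node_poly (nodes x (j + 1) k))"]
    by simp
  have "x l = v" if "l \<in> {i + 1..<i + 1 + int k}" for l
  proof -
    have "poly (node_poly (nodes x (i + 1) k)) (x l) = 0"
      using that by (simp add: node_poly_root_iff)
    then show ?thesis by (simp add: eq)
  qed
  from this[of "i + 1"] this[of "i + 2"] show False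
    using knot_simple[OF assms(1,2) _ _ assms(4,5), of "i + 1" "i + 2"] assms(3) by auto
qed

text \<open>Serves the end points, which are knots of multiplicity \<open>k + 1\<close>: the sign
  and both moment identities, known at interior points, pass to the limit.\<close>

lemma weight_limit:
  assumes "knot_sequence n k x" "mono x" "k > 0" "F \<noteq> bot" "((\<lambda>v. v) \<longlongrightarrow> p) F"
    and "\<And>c. eventually (\<lambda>v. v \<le> c) F \<or> eventually (\<lambda>v. c < v) F"
    and inside: "eventually (\<lambda>v. 0 < v \<and> v < 1) F"
  obtains w where "\<And>j. ((\<lambda>v. weight x k v j) \<longlongrightarrow> w j) F"
    "\<And>j. 0 \<le> w j" "(\<Sum>j=- int k..int n - 1. w j) = 1"
    "(\<Sum>j=- int k..int n - 1. greville x j k * w j) = p"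
proof -
  obtain l where l: "\<And>j. ((\<lambda>v. cum x v k j) \<longlongrightarrow> l j) F"
    using cum_limit[OF assms(2,5,6)] by metis
  define w where "w j = l (j + 1) - l j" for j
  have w: "((\<lambda>v. weight x k v j) \<longlongrightarrow> w j) F" for j
    unfolding weight_def w_def by (intro tendsto_diff l)
  show thesis
  proof
    show "((\<lambda>v. weight x k v j) \<longlongrightarrow> w j) F" for j by (fact w)
    show "0 \<le> w j" for j
      using tendsto_lowerbound[OF w _ assms(4)] weight_nonneg[OF assms(2)] by simp
    have "((\<lambda>v. \<Sum>j=- int k..int n - 1. weight x k v j) \<longlongrightarrow> 1) F"
      by (rule tendsto_eventually, rule eventually_mono[OF inside])
        (use sum_weight[OF assms(1,2)] in auto)
    moreover have "((\<lambda>v. \<Sum>j=- int k..int n - 1. weight x k v j) \<longlongrightarrow> (\<Sum>j=- int k..int n - 1. w j)) F"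
      by (intro tendsto_sum w)
    ultimately show "(\<Sum>j=- int k..int n - 1. w j) = 1"
      using tendsto_unique[OF assms(4)] by blast
    have "((\<lambda>v. \<Sum>j=- int k..int n - 1. greville x j k * weight x k v j) \<longlongrightarrow> p) F"
      by (rule Lim_transform_eventually[OF assms(5)], rule eventually_mono[OF inside])
        (use sum_greville_weight[OF assms(1-3)] in auto)
    moreover have "((\<lambda>v. \<Sum>j=- int k..int n - 1. greville x j k * weight x k v j) \<longlongrightarrow>
        (\<Sum>j=- int k..int n - 1. greville x j k * w j)) F"
      by (intro tendsto_sum tendsto_mult_left w)
    ultimately show "(\<Sum>j=- int k..int n - 1. greville x j k * w j) = p"
      using tendsto_unique[OF assms(4)] by blast
  qed
qed

lemma bspline_inside:
  assumes "knot_sequence n k x" "mono x" "k > 0" "0 < v" "v < 1"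
  shows "bspline x j k v = weight x k v j"
  using bspline_eq_weight[OF assms] assms(4) by (simp add: bspline_def)

text \<open>The weights are chosen before \<open>f\<close>, so that they describe the operator as a
  whole. At the end points they are one-sided limits of the interior weights.\<close>

lemma schoenberg_representation:
  assumes K: "knot_sequence n k x" "mono x" and "k \<ge> 2"
  shows "\<forall>u\<in>{0..1}. \<exists>w. (\<forall>j\<in>{- int k..int n - 1}. 0 \<le> w j) \<and> (\<Sum>j=- int k..int n - 1. w j) = 1 \<and>
     (\<Sum>j=- int k..int n - 1. greville x j k * w j) = u \<and>
     (0 < u \<and> u < 1 \<longrightarrow> 0 < (\<Sum>j=- int k..int n - 1. (greville x j k - u)\<^sup>2 * w j)) \<and>
     (\<forall>f. schoenberg n k x f u = (\<Sum>j=- int k..int n - 1. f (greville x j k) * w j))"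
proof
  fix u :: real
  assume u: "u \<in> {0..1}"
  have k: "k > 0" using assms(3) by simp
  consider "u = 0" | "u = 1" | "0 < u" "u < 1"
    using u by fastforce
  then show "\<exists>w. (\<forall>j\<in>{- int k..int n - 1}. 0 \<le> w j) \<and> (\<Sum>j=- int k..int n - 1. w j) = 1 \<and>
     (\<Sum>j=- int k..int n - 1. greville x j k * w j) = u \<and>
     (0 < u \<and> u < 1 \<longrightarrow> 0 < (\<Sum>j=- int k..int n - 1. (greville x j k - u)\<^sup>2 * w j)) \<and>
     (\<forall>f. schoenberg n k x f u = (\<Sum>j=- int k..int n - 1. f (greville x j k) * w j))"
  proof cases
    case 1
    have inside: "eventually (\<lambda>v. 0 < v \<and> v < 1) (at_right (0::real))"
      unfolding eventually_at_right_field by (intro exI[of _ 1]) auto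
    have "eventually (\<lambda>v. v \<le> c) (at_right 0) \<or> eventually (\<lambda>v. c < v) (at_right 0)" for c :: real
    proof (cases "c \<le> 0")
      case True
      then have "eventually (\<lambda>v. c < v) (at_right 0)"
        unfolding eventually_at_right_field by (intro exI[of _ 1]) auto
      then show ?thesis by blast
    next
      case False
      then have "eventually (\<lambda>v. v \<le> c) (at_right 0)"
        unfolding eventually_at_right_field by (intro exI[of _ c]) auto
      then show ?thesis by blast
    qed
    then obtain w where w: "\<And>j. ((\<lambda>v. weight x k v j) \<longlongrightarrow> w j) (at_right 0)"
      "\<And>j. 0 \<le> w j" "(\<Sum>j=- int k..int n - 1. w j) = 1"
      "(\<Sum>j=- int k..int n - 1. greville x j k * w j) = 0"
      using weight_limit[OF K k _ _ _ inside, of 0] by (auto intro: tendsto_ident_at)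
    have "((\<lambda>v. (x (j + int k + 1) - x j) * divided_difference (map x [j..j + int k + 1])
        (\<lambda>y. trunc_power k (y - v))) \<longlongrightarrow> w j) (at_right 0)" for j
      by (rule Lim_transform_eventually[OF w(1)], rule eventually_mono[OF inside])
        (use bspline_eq_weight[OF K k] in auto)
    then have "bspline x j k 0 = w j" for j
      by (simp add: bspline_def tendsto_Lim)
    then have "schoenberg n k x f u = (\<Sum>j=- int k..int n - 1. f (greville x j k) * w j)" for f
      using 1 by (simp add: schoenberg_def)
    with 1 w show ?thesis by blast
  next
    case 2
    have inside: "eventually (\<lambda>v. 0 < v \<and> v < 1) (at_left (1::real))"
      unfolding eventually_at_left_field by (intro exI[of _ 0]) auto
    have "eventually (\<lambda>v. v \<le> c) (at_left 1) \<or> eventually (\<lambda>v. c < v) (at_left 1)" for c :: real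
    proof (cases "c < 1")
      case True
      then have "eventually (\<lambda>v. c < v) (at_left 1)"
        unfolding eventually_at_left_field by (intro exI[of _ c]) auto
      then show ?thesis by blast
    next
      case False
      then have "eventually (\<lambda>v. v \<le> c) (at_left 1)"
        unfolding eventually_at_left_field by (intro exI[of _ 0]) auto
      then show ?thesis by blast
    qed
    then obtain w where w: "\<And>j. ((\<lambda>v. weight x k v j) \<longlongrightarrow> w j) (at_left 1)"
      "\<And>j. 0 \<le> w j" "(\<Sum>j=- int k..int n - 1. w j) = 1"
      "(\<Sum>j=- int k..int n - 1. greville x j k * w j) = 1"
      using weight_limit[OF K k _ _ _ inside, of 1] by (auto intro: tendsto_ident_at)
    have "schoenberg n k x f u = (\<Sum>j=- int k..int n - 1. f (greville x j k) * w j)" for f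
    proof -
      have "((\<lambda>v. \<Sum>j=- int k..int n - 1. f (greville x j k) * weight x k v j) \<longlongrightarrow>
          (\<Sum>j=- int k..int n - 1. f (greville x j k) * w j)) (at_left 1)"
        by (intro tendsto_sum tendsto_mult_left w)
      \<comment> \<open>At \<open>1\<close> the definition takes the limit of the whole sum, so the
        limit is transferred from the sum with \<open>weight\<close> to the one with
        \<open>bspline\<close>.\<close>
      then have "((\<lambda>v. \<Sum>j=- int k..int n - 1. f (greville x j k) * bspline x j k v) \<longlongrightarrow>
          (\<Sum>j=- int k..int n - 1. f (greville x j k) * w j)) (at_left 1)"
        by (rule Lim_transform_eventually, intro eventually_mono[OF inside])
          (use bspline_inside[OF K k] in auto)
      then show ?thesis
        using 2 by (simp add: schoenberg_def tendsto_Lim)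
    qed
    with 2 w show ?thesis by blast
  next
    case 3
    have "schoenberg n k x f u = (\<Sum>j=- int k..int n - 1. f (greville x j k) * weight x k u j)" for f
      using 3 by (simp add: schoenberg_def bspline_inside[OF K k])
    then show ?thesis
      using weight_nonneg[OF K(2)] sum_weight[OF K 3] sum_greville_weight[OF K k 3]
        variance_weight_pos[OF K assms(3) 3] by blast
  qed
qed

subsection \<open>Second differences\<close>

lemma sup_norm_le: "(\<And>u. u \<in> {0..1} \<Longrightarrow> \<bar>g u\<bar> \<le> B) \<Longrightarrow> sup_norm g \<le> B"
  unfolding sup_norm_def by (rule cSUP_least) auto

lemma le_sup_norm:
  assumes "\<And>u. u \<in> {0..1} \<Longrightarrow> \<bar>g u\<bar> \<le> B" "u \<in> {0..1}"
  shows "\<bar>g u\<bar> \<le> sup_norm g"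
  unfolding sup_norm_def using assms by (intro cSUP_upper bdd_aboveI2[of _ _ B]) auto

lemma omega2_le:
  assumes "0 < t" "t \<le> 1/2"
    and "\<And>h u. 0 < h \<Longrightarrow> h < t \<Longrightarrow> u \<in> {0..1 - 2 * h} \<Longrightarrow>
           \<bar>f u - 2 * f (u + h) + f (u + 2 * h)\<bar> \<le> C"
  shows "omega2 f t \<le> C"
  unfolding omega2_def using assms by (intro cSUP_least) auto

lemma second_difference_le:
  fixes f :: "real \<Rightarrow> real"
  assumes "\<And>u. u \<in> {0..1} \<Longrightarrow> \<bar>f u\<bar> \<le> B" "0 < h" "u \<in> {0..1 - 2 * h}"
  shows "\<bar>f u - 2 * f (u + h) + f (u + 2 * h)\<bar> \<le> 4 * B"
  using assms(1)[of u] assms(1)[of "u + h"] assms(1)[of "u + 2 * h"] assms(2,3) by auto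

text \<open>A supremum of reals is informative only for a bounded set; \<open>4 * B\<close> bounds
  both the inner and the outer one.\<close>

lemma le_omega2:
  assumes "t \<le> 1/2" and bound: "\<And>u. u \<in> {0..1} \<Longrightarrow> \<bar>f u\<bar> \<le> B"
    and h: "0 < h" "h < t" "u \<in> {0..1 - 2 * h}"
  shows "\<bar>f u - 2 * f (u + h) + f (u + 2 * h)\<bar> \<le> omega2 f t"
proof -
  let ?D = "\<lambda>h u. \<bar>f u - 2 * f (u + h) + f (u + 2 * h)\<bar>"
  have "?D h u \<le> (SUP u\<in>{0..1 - 2 * h}. ?D h u)"
    using h second_difference_le[of f B, OF bound] by (intro cSUP_upper bdd_aboveI2[of _ _ "4 * B"]) auto
  also have "\<dots> \<le> omega2 f t"
    unfolding omega2_def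
  proof (rule cSUP_upper)
    show "bdd_above ((\<lambda>h. SUP u\<in>{0..1 - 2 * h}. ?D h u) ` {0<..<t})"
    proof (rule bdd_aboveI2)
      fix h assume "h \<in> {0<..<t}"
      then show "(SUP u\<in>{0..1 - 2 * h}. ?D h u) \<le> 4 * B"
        using assms(1) second_difference_le[of f B, OF bound] by (intro cSUP_least) auto
    qed
  qed (use h in simp)
  finally show ?thesis .
qed

text \<open>The first differences vary by at most \<open>N * \<omega>\<close> and add up to zero, so
  each is at most \<open>N * \<omega>\<close> in size; every value is a sum of at most
  \<open>N\<close> of them.\<close>

lemma second_differences_control_grid:
  fixes G :: "nat \<Rightarrow> real"
  assumes "G 0 = 0" "G N = 0" and "0 \<le> \<omega>"
    and step: "\<And>i. i + 2 \<le> N \<Longrightarrow> \<bar>G i - 2 * G (i + 1) + G (i + 2)\<bar> \<le> \<omega>"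
    and "i \<le> N"
  shows "\<bar>G i\<bar> \<le> real N ^ 2 * \<omega>"
proof -
  define d where "d i = G (i + 1) - G i" for i
  have forward: "\<bar>d (i + m) - d i\<bar> \<le> real m * \<omega>" if "i + m < N" for i m
    using that
  proof (induction m)
    case (Suc m)
    have "\<bar>d (i + m) - d i\<bar> \<le> real m * \<omega>" using Suc by simp
    moreover have "\<bar>d (i + Suc m) - d (i + m)\<bar> \<le> \<omega>"
      using step[of "i + m"] Suc.prems by (simp add: d_def)
    ultimately show ?case by (simp add: algebra_simps)
  qed simp
  have close: "\<bar>d j - d i\<bar> \<le> real N * \<omega>" if "i < N" "j < N" for i j
  proof -
    have "\<bar>d j - d i\<bar> \<le> real (max i j - min i j) * \<omega>"
      using forward[of "min i j" "max i j - min i j"] that by (auto simp: min_def max_def)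
    also have "\<dots> \<le> real N * \<omega>"
      using that assms(3) by (intro mult_right_mono) auto
    finally show ?thesis .
  qed
  have sum_d: "(\<Sum>l<m. d l) = G m" for m
    using assms(1) sum_lessThan_telescope[of G m] by (simp add: d_def)
  have d: "\<bar>d j\<bar> \<le> real N * \<omega>" if "j < N" for j
  proof -
    \<comment> \<open>The subtracted terms add up to \<open>G N = 0\<close>.\<close>
    have "real N * d j = (\<Sum>i<N. d j - d i)"
      by (simp add: sum_subtractf sum_d assms(2))
    also have "\<bar>\<dots>\<bar> \<le> (\<Sum>i<N. real N * \<omega>)"
      using close that by (intro order_trans[OF sum_abs] sum_mono) auto
    finally have "real N * \<bar>d j\<bar> \<le> real N * (real N * \<omega>)"
      by (simp add: abs_mult)
    then show ?thesis using that by simp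
  qed
  have "\<bar>G i\<bar> \<le> (\<Sum>l<i. real N * \<omega>)"
    unfolding sum_d[symmetric] using d assms(5) by (intro order_trans[OF sum_abs] sum_mono) auto
  also have "\<dots> \<le> real N * (real N * \<omega>)"
    using assms(3,5) by (simp add: mult_right_mono)
  finally show ?thesis by (simp add: power2_eq_square mult.assoc)
qed

text \<open>Grid values are controlled on a mesh finer than \<open>t\<close>, the other values by
  reflecting a grid point. The bound \<open>B\<close> makes the suprema finite and does not enter
  \<open>M\<close>.\<close>

lemma whitney_constant:
  fixes t :: real
  assumes "0 < t" "t \<le> 1/2"
  shows "\<exists>M>0. \<forall>g B u. g 0 = 0 \<longrightarrow> g 1 = 0 \<longrightarrow> (\<forall>u\<in>{0..1}. \<bar>g u\<bar> \<le> B) \<longrightarrow> u \<in> {0..1} \<longrightarrow>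
           \<bar>g u\<bar> \<le> M * omega2 g t"
proof -
  obtain N :: nat where N: "N > 0" "1 / real N < t"
    using assms(1) reals_Archimedean[of t] by (metis inverse_eq_divide of_nat_Suc zero_less_Suc)
  have "\<bar>g u\<bar> \<le> (real N ^ 2 + 1) * omega2 g t"
    if g: "g 0 = 0" "g 1 = 0" "\<forall>u\<in>{0..1}. \<bar>g u\<bar> \<le> B" and u: "u \<in> {0..1}" for g B u
  proof -
    define \<omega> where "\<omega> = omega2 g t"
    have \<omega>: "\<bar>g u - 2 * g (u + h) + g (u + 2 * h)\<bar> \<le> \<omega>"
      if "0 < h" "h < t" "u \<in> {0..1 - 2 * h}" for h u
      unfolding \<omega>_def using le_omega2[OF assms(2) _ that] g(3) by blast
    have "0 \<le> \<omega>"
      using \<omega>[of "t / 2" 0] assms by (auto intro: order_trans[OF abs_ge_zero])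
    have grid: "\<bar>g (real i / real N)\<bar> \<le> real N ^ 2 * \<omega>" if "i \<le> N" for i
    proof (rule second_differences_control_grid[OF _ _ \<open>0 \<le> \<omega>\<close> _ that])
      fix i assume "i + 2 \<le> N"
      then have "real i / real N \<in> {0..1 - 2 * (1 / real N)}"
        using N(1) by (auto simp: field_simps)
      then show "\<bar>g (real i / real N) - 2 * g (real (i + 1) / real N) + g (real (i + 2) / real N)\<bar> \<le> \<omega>"
        using \<omega>[of "1 / real N" "real i / real N"] N by (simp add: add_divide_distrib ac_simps)
    qed (use g N(1) in auto)
    define m where "m = sup_norm g"
    have m: "\<bar>g v\<bar> \<le> m" if "v \<in> {0..1}" for v
      unfolding m_def using le_sup_norm[OF _ that] g(3) by blast
    have half: "\<bar>g v\<bar> \<le> (\<omega> + real N ^ 2 * \<omega> + m) / 2" if v: "v \<in> {0..1}" for v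
    proof -
      text \<open>
        The second difference at \<open>a\<close>, \<open>v\<close>, \<open>p\<close> has a step below \<open>t\<close>; it bounds the supremum of
        \<open>\<bar>g\<bar>\<close> by half of itself plus terms already controlled.
      \<close>
      define i where "i = nat (round (v * real N))"
      define a where "a = real i / real N"
      define p where "p = 2 * v - a"
      have vN: "0 \<le> v * real N" "v * real N \<le> real N"
        using v by (auto simp: mult_left_le_one_le)
      have "0 \<le> round (v * real N)" "round (v * real N) \<le> int N"
        using round_mono[OF vN(1)] round_mono[OF vN(2)] by simp_all
      then have i: "real i = of_int (round (v * real N))" "i \<le> N"
        by (auto simp: i_def)
      then have near: "\<bar>v * real N - real i\<bar> \<le> 1/2"
        using of_int_round_abs_le[of "v * real N"] by (simp add: abs_minus_commute)
      have aN: "a * real N = real i" "0 \<le> a" "a \<le> 1"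
        using N(1) i(2) by (auto simp: a_def)
      have ga: "\<bar>g a\<bar> \<le> real N ^ 2 * \<omega>"
        unfolding a_def using grid i(2) by blast
      have "\<bar>v * real N - real i\<bar> = \<bar>v - a\<bar> * real N"
        unfolding aN(1)[symmetric] left_diff_distrib[symmetric] abs_mult by simp
      with near have "\<bar>v - a\<bar> * real N \<le> 1/2" by simp
      then have "\<bar>v - a\<bar> \<le> 1 / real N"
        using N(1) by (simp add: field_simps)
      then have dist: "\<bar>v - a\<bar> < t" using N(2) by linarith
      \<comment> \<open>Here \<open>a\<close> must be a nearest grid point: \<open>p * N\<close> is
        at least \<open>i - 1\<close> and at most \<open>i + 1\<close>, which suffices unless
        \<open>i\<close> is \<open>0\<close> or \<open>N\<close>; in those cases \<open>p\<close> is
        \<open>2 * v\<close> or \<open>2 * v - 1\<close>, and the bound in question is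
        immediate.\<close>
      have "p \<in> {0..1}"
      proof -
        have pN: "p * real N = 2 * (v * real N) - real i"
          using aN(1) by (simp add: p_def algebra_simps)
        have "0 \<le> p * real N"
        proof (cases "i = 0")
          case False
          then have "1 \<le> real i" by simp
          then show ?thesis using near pN by linarith
        qed (use vN pN in linarith)
        moreover have "p * real N \<le> real N"
        proof (cases "i = N")
          case False
          then have "real i + 1 \<le> real N" using i(2) by linarith
          then show ?thesis using near pN by linarith
        qed (use vN pN in linarith)
        ultimately show ?thesis
          using N(1) by (auto simp: zero_le_mult_iff)
      qed
      then have gp: "\<bar>g p\<bar> \<le> m" by (rule m)
      consider "v = a" | "a < v" | "v < a" by linarith
      then show ?thesis
      proof cases
        case 1
        then show ?thesis using ga m[OF v] \<open>0 \<le> \<omega>\<close> by simp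
      next
        case 2
        have "\<bar>g a - 2 * g v + g p\<bar> \<le> \<omega>"
          using \<omega>[of "v - a" a] 2 dist \<open>p \<in> {0..1}\<close> aN by (simp add: p_def algebra_simps)
        then show ?thesis using ga gp by (simp add: field_simps)
      next
        case 3
        have "\<bar>g p - 2 * g v + g a\<bar> \<le> \<omega>"
          using \<omega>[of "a - v" p] 3 dist \<open>p \<in> {0..1}\<close> aN by (simp add: p_def algebra_simps)
        then show ?thesis using ga gp by (simp add: field_simps)
      qed
    qed
    \<comment> \<open>Taking the supremum over \<open>v\<close> puts \<open>m\<close> on both sides,
      with factor one half on the right, where it is absorbed.\<close>
    have "m \<le> (\<omega> + real N ^ 2 * \<omega> + m) / 2"
      unfolding m_def using half[unfolded m_def] by (rule sup_norm_le)
    then have "m \<le> (real N ^ 2 + 1) * \<omega>"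
      by (simp add: algebra_simps)
    then show ?thesis
      using m[OF u] by (simp add: \<omega>_def)
  qed
  then show ?thesis
    by (intro exI[of _ "real N ^ 2 + 1"]) (auto intro: add_nonneg_pos)
qed

subsection \<open>Averaging operators\<close>

text \<open>Isolates what the estimates need from the B-splines. \<open>spread\<close> is restricted
  to interior points because nodes in the unit interval with mean \<open>0\<close> or
  \<open>1\<close> have variance zero.\<close>

locale averaging_operator =
  fixes J :: "'i set" and \<xi> :: "'i \<Rightarrow> real" and w :: "real \<Rightarrow> 'i \<Rightarrow> real"
  assumes finite_J: "finite J"
    and node: "j \<in> J \<Longrightarrow> \<xi> j \<in> {0..1}"
    and nonneg: "u \<in> {0..1} \<Longrightarrow> j \<in> J \<Longrightarrow> 0 \<le> w u j"
    and total: "u \<in> {0..1} \<Longrightarrow> (\<Sum>j\<in>J. w u j) = 1"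
    and mean: "u \<in> {0..1} \<Longrightarrow> (\<Sum>j\<in>J. \<xi> j * w u j) = u"
    and spread: "0 < u \<Longrightarrow> u < 1 \<Longrightarrow> 0 < (\<Sum>j\<in>J. (\<xi> j - u)\<^sup>2 * w u j)"
begin

definition T :: "(real \<Rightarrow> real) \<Rightarrow> real \<Rightarrow> real" where
  "T f u = (\<Sum>j\<in>J. f (\<xi> j) * w u j)"

lemma T_le:
  assumes "\<And>j. j \<in> J \<Longrightarrow> f (\<xi> j) \<le> B" "u \<in> {0..1}"
  shows "T f u \<le> B"
proof -
  have "T f u \<le> (\<Sum>j\<in>J. B * w u j)"
    unfolding T_def using assms nonneg by (intro sum_mono mult_right_mono) auto
  then show ?thesis
    using total[OF assms(2)] by (simp flip: sum_distrib_left)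
qed

lemma T_diff: "T (\<lambda>s. f s - g s) u = T f u - T g u"
  by (simp add: T_def left_diff_distrib sum_subtractf)

lemma T_scale: "T (\<lambda>s. c * f s) u = c * T f u"
  by (simp add: T_def sum_distrib_left mult.assoc)

lemma T_uminus: "T (\<lambda>s. - f s) u = - T f u"
  by (simp add: T_def sum_negf)

lemma T_abs_le:
  assumes "\<And>j. j \<in> J \<Longrightarrow> \<bar>f (\<xi> j)\<bar> \<le> B" "u \<in> {0..1}"
  shows "\<bar>T f u\<bar> \<le> B"
  using T_le[of f B u] T_le[of "\<lambda>s. - f s" B u] assms by (fastforce simp: T_uminus abs_le_iff)

lemma T_affine: "u \<in> {0..1} \<Longrightarrow> T (\<lambda>s. a + b * s) u = a + b * u"
  using total[of u] mean[of u]
  by (simp add: T_def distrib_right sum.distrib mult.assoc flip: sum_distrib_left)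

text \<open>Expand \<open>s * (1 - s)\<close> into an affine function of \<open>s\<close> minus the
  square of \<open>s - u\<close>; the affine part is reproduced.\<close>

lemma T_parabola:
  assumes "u \<in> {0..1}"
  shows "T (\<lambda>s. s * (1 - s)) u = u * (1 - u) - (\<Sum>j\<in>J. (\<xi> j - u)\<^sup>2 * w u j)"
proof -
  have "T (\<lambda>s. s * (1 - s)) u = (\<Sum>j\<in>J. (1 - 2 * u) * (\<xi> j * w u j) + u\<^sup>2 * w u j - (\<xi> j - u)\<^sup>2 * w u j)"
    unfolding T_def by (intro sum.cong) (auto simp: power2_eq_square algebra_simps)
  also have "\<dots> = (1 - 2 * u) * u + u\<^sup>2 - (\<Sum>j\<in>J. (\<xi> j - u)\<^sup>2 * w u j)"
    using total[OF assms] mean[OF assms]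
    by (simp add: sum.distrib sum_subtractf flip: sum_distrib_left)
  finally show ?thesis by (simp add: power2_eq_square algebra_simps)
qed

text \<open>The maximum principle is evaluated only at nodes, so a minimum over finitely many
  variances suffices.\<close>

lemma spread_uniform:
  "\<exists>\<delta>>0. \<forall>i\<in>J. 0 < \<xi> i \<and> \<xi> i < 1 \<longrightarrow> \<delta> \<le> (\<Sum>j\<in>J. (\<xi> j - \<xi> i)\<^sup>2 * w (\<xi> i) j)"
proof -
  \<comment> \<open>The extra \<open>1\<close> keeps the set nonempty when no node is
    interior.\<close>
  define V where "V = insert 1 ((\<lambda>i. \<Sum>j\<in>J. (\<xi> j - \<xi> i)\<^sup>2 * w (\<xi> i) j) ` {i \<in> J. 0 < \<xi> i \<and> \<xi> i < 1})"
  have V: "finite V" "V \<noteq> {}" "\<forall>v\<in>V. 0 < v"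
    using finite_J spread by (auto simp: V_def)
  then have "0 < Min V" by simp
  moreover have "Min V \<le> (\<Sum>j\<in>J. (\<xi> j - \<xi> i)\<^sup>2 * w (\<xi> i) j)"
    if "i \<in> J" "0 < \<xi> i" "\<xi> i < 1" for i
    using that V(1) by (intro Min_le) (auto simp: V_def)
  ultimately show ?thesis by blast
qed

text \<open>
  Maximum principle with the barrier \<open>c s (1 - s)\<close>, whose defect under \<open>T\<close> is the variance
  of the weights.
\<close>

lemma node_values_le:
  assumes \<delta>: "\<forall>i\<in>J. 0 < \<xi> i \<and> \<xi> i < 1 \<longrightarrow> \<delta> \<le> (\<Sum>j\<in>J. (\<xi> j - \<xi> i)\<^sup>2 * w (\<xi> i) j)"
    and g: "g 0 = 0" "g 1 = 0" "\<And>u. u \<in> {0..1} \<Longrightarrow> g u - T g u \<le> \<epsilon>"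
    and c: "0 \<le> c" "\<epsilon> < c * \<delta>" and j: "j \<in> J"
  shows "g (\<xi> j) \<le> c"
proof -
  define z where "z s = g s - c * (s * (1 - s))" for s
  obtain i where i: "i \<in> J" "\<And>j. j \<in> J \<Longrightarrow> z (\<xi> j) \<le> z (\<xi> i)"
  proof -
    have "Max ((\<lambda>j. z (\<xi> j)) ` J) \<in> (\<lambda>j. z (\<xi> j)) ` J"
      using finite_J j by (intro Max_in) auto
    then obtain i where i: "i \<in> J" "Max ((\<lambda>j. z (\<xi> j)) ` J) = z (\<xi> i)" by auto
    show thesis
    proof (rule that[OF i(1)])
      fix j assume "j \<in> J"
      then have "z (\<xi> j) \<le> Max ((\<lambda>j. z (\<xi> j)) ` J)"
        using finite_J by (intro Max_ge) auto
      then show "z (\<xi> j) \<le> z (\<xi> i)" by (simp only: i(2))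
    qed
  qed
  have "z (\<xi> i) \<le> 0"
  proof (rule ccontr)
    assume "\<not> z (\<xi> i) \<le> 0"
    \<comment> \<open>\<open>z\<close> vanishes at \<open>0\<close> and \<open>1\<close>, so a
      positive maximum sits at an interior node, where the variance is at least
      \<open>\<delta>\<close>.\<close>
    then have "\<xi> i \<noteq> 0" "\<xi> i \<noteq> 1"
      using g(1,2) by (auto simp: z_def)
    then have inside: "0 < \<xi> i" "\<xi> i < 1" "\<xi> i \<in> {0..1}"
      using node[OF i(1)] by auto
    have "T z (\<xi> i) \<le> z (\<xi> i)"
      using i(2) inside(3) by (intro T_le)
    moreover have "T z (\<xi> i) = T g (\<xi> i) - c * (\<xi> i * (1 - \<xi> i)) +
        c * (\<Sum>j\<in>J. (\<xi> j - \<xi> i)\<^sup>2 * w (\<xi> i) j)"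
      unfolding z_def T_diff T_scale T_parabola[OF inside(3)] by (simp add: right_diff_distrib)
    moreover have "c * \<delta> \<le> c * (\<Sum>j\<in>J. (\<xi> j - \<xi> i)\<^sup>2 * w (\<xi> i) j)"
      using \<delta> i(1) inside c(1) by (intro mult_left_mono) auto
    \<comment> \<open>Rearranging \<open>T z \<le> z\<close> at the maximum gives
      \<open>c * \<delta> \<le> g - T g \<le> \<epsilon>\<close> there, contrary to the choice of
      \<open>c\<close>.\<close>
    ultimately show False
      using g(3)[OF inside(3)] c(2) unfolding z_def by linarith
  qed
  then have "g (\<xi> j) \<le> c * (\<xi> j * (1 - \<xi> j))"
    using i(2)[OF j] by (simp add: z_def)
  also have "\<dots> \<le> c * 1"
    using c(1) node[OF j] by (intro mult_left_mono mult_le_one) auto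
  finally show ?thesis by simp
qed

text \<open>\<open>T g\<close> depends only on the node values, which the maximum principle bounds
  by \<open>\<epsilon> / \<delta>\<close>; the defect adds another
  \<open>\<epsilon>\<close>.\<close>

lemma stability:
  "\<exists>C>0. \<forall>g \<epsilon> u. g 0 = 0 \<longrightarrow> g 1 = 0 \<longrightarrow> (\<forall>u\<in>{0..1}. \<bar>g u - T g u\<bar> \<le> \<epsilon>) \<longrightarrow> u \<in> {0..1} \<longrightarrow>
     \<bar>g u\<bar> \<le> C * \<epsilon>"
proof -
  obtain \<delta> where \<delta>: "0 < \<delta>"
    "\<forall>i\<in>J. 0 < \<xi> i \<and> \<xi> i < 1 \<longrightarrow> \<delta> \<le> (\<Sum>j\<in>J. (\<xi> j - \<xi> i)\<^sup>2 * w (\<xi> i) j)"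
    using spread_uniform by blast
  have "\<bar>g u\<bar> \<le> (1 + 1 / \<delta>) * \<epsilon>"
    if g: "g 0 = 0" "g 1 = 0" "\<forall>u\<in>{0..1}. \<bar>g u - T g u\<bar> \<le> \<epsilon>" and u: "u \<in> {0..1}" for g \<epsilon> u
  proof -
    have "0 \<le> \<epsilon>"
      using g(3) u by (meson abs_ge_zero order_trans)
    have nodes: "\<bar>g (\<xi> j)\<bar> \<le> \<epsilon> / \<delta>" if "j \<in> J" for j
    \<comment> \<open>The barrier argument needs a strict inequality, so it is run for every
      \<open>c\<close> above the target.\<close>
    proof (rule dense_ge)
      fix c assume "\<epsilon> / \<delta> < c"
      moreover have "0 \<le> \<epsilon> / \<delta>"
        using \<open>0 \<le> \<epsilon>\<close> \<delta>(1) by simp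
      ultimately have c: "0 \<le> c" "\<epsilon> < c * \<delta>"
        using \<delta>(1) by (linarith, simp add: field_simps)
      have "g (\<xi> j) \<le> c"
        using g by (intro node_values_le[OF \<delta>(2) _ _ _ c that]) (auto simp: abs_le_iff)
      moreover have "- g (\<xi> j) \<le> c"
        using g by (intro node_values_le[OF \<delta>(2) _ _ _ c that, of "\<lambda>s. - g s"])
          (fastforce simp: abs_le_iff T_uminus)+
      ultimately show "\<bar>g (\<xi> j)\<bar> \<le> c" by (simp add: abs_le_iff)
    qed
    have "\<bar>T g u\<bar> \<le> \<epsilon> / \<delta>"
      using nodes u by (intro T_abs_le)
    moreover have "\<bar>g u - T g u\<bar> \<le> \<epsilon>" using g(3) u by blast
    ultimately show ?thesis by (simp add: distrib_right)
  qed
  moreover have "0 < 1 + 1 / \<delta>" using \<delta>(1) by (simp add: add_pos_pos)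
  ultimately show ?thesis by blast
qed

text \<open>Subtracting the chord of \<open>f\<close> changes neither the second differences nor the
  defect, because \<open>T\<close> reproduces affine functions. \<open>M1\<close> comes from
  \<open>stability\<close> alone, hence precedes \<open>t\<close>.\<close>

lemma equivalence:
  "\<exists>M1>0. \<forall>t. 0 < t \<and> t \<le> 1/2 \<longrightarrow>
     (\<exists>M2>0. \<forall>f :: real \<Rightarrow> real. continuous_on {0..1} f \<longrightarrow>
        M1 * omega2 f t \<le> sup_norm (\<lambda>u. f u - T f u) \<and>
        sup_norm (\<lambda>u. f u - T f u) \<le> M2 * omega2 f t)"
proof -
  obtain C where C: "0 < C" and stable: "\<And>g \<epsilon> u. g 0 = 0 \<Longrightarrow> g 1 = 0 \<Longrightarrow>
      (\<forall>u\<in>{0..1}. \<bar>g u - T g u\<bar> \<le> \<epsilon>) \<Longrightarrow> u \<in> {0..1} \<Longrightarrow> \<bar>g u\<bar> \<le> C * \<epsilon>"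
    using stability by blast
  show ?thesis
  \<comment> \<open>A second difference is at most four times the supremum of \<open>g\<close>,
    which is at most \<open>C\<close> times the defect.\<close>
  proof (rule exI[of _ "1 / (4 * C)"], intro conjI allI impI)
    fix t :: real
    assume t: "0 < t \<and> t \<le> 1/2"
    obtain M where M: "0 < M" and whitney: "\<And>g B u. g 0 = 0 \<Longrightarrow> g 1 = 0 \<Longrightarrow>
        (\<forall>u\<in>{0..1}. \<bar>g u\<bar> \<le> B) \<Longrightarrow> u \<in> {0..1} \<Longrightarrow> \<bar>g u\<bar> \<le> M * omega2 g t"
      using whitney_constant[of t] t by blast
    show "\<exists>M2>0. \<forall>f :: real \<Rightarrow> real. continuous_on {0..1} f \<longrightarrow>
        1 / (4 * C) * omega2 f t \<le> sup_norm (\<lambda>u. f u - T f u) \<and>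
        sup_norm (\<lambda>u. f u - T f u) \<le> M2 * omega2 f t"
    \<comment> \<open>One \<open>M\<close> for \<open>g\<close> and one for
      \<open>T g\<close>.\<close>
    proof (rule exI[of _ "2 * M"], intro conjI allI impI)
      fix f :: "real \<Rightarrow> real"
      assume cont: "continuous_on {0..1} f"
      define g where "g s = f s - (f 0 + (f 1 - f 0) * s)" for s
      have g01: "g 0 = 0" "g 1 = 0" by (simp_all add: g_def)
      have diff: "g u - T g u = f u - T f u" if "u \<in> {0..1}" for u
        using that unfolding g_def T_diff by (simp add: T_affine)
      have "continuous_on {0..1} g"
        unfolding g_def by (intro continuous_intros cont)
      then have "bounded (g ` {0..1})"
        by (intro compact_imp_bounded compact_continuous_image) auto
      then obtain B where B: "\<forall>u\<in>{0..1}. \<bar>g u\<bar> \<le> B"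
        by (auto simp: bounded_iff)
      have omega: "omega2 f t = omega2 g t"
        unfolding omega2_def g_def
        by (intro SUP_cong refl arg_cong[of _ _ abs]) (simp add: algebra_simps)
      have "\<bar>T g u\<bar> \<le> B" if "u \<in> {0..1}" for u
        using that B node by (intro T_abs_le) auto
      with B have "\<bar>f u - T f u\<bar> \<le> B + B" if "u \<in> {0..1}" for u
        using that unfolding diff[OF that, symmetric]
        by (meson abs_triangle_ineq4 add_mono order_trans)
      then have "\<bar>g u - T g u\<bar> \<le> sup_norm (\<lambda>u. f u - T f u)" if "u \<in> {0..1}" for u
        using le_sup_norm[of "\<lambda>u. f u - T f u" "B + B" u] that diff by simp
      then have "\<bar>g u\<bar> \<le> C * sup_norm (\<lambda>u. f u - T f u)" if "u \<in> {0..1}" for u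
        using stable[OF g01 _ that] by blast
      then have "omega2 g t \<le> 4 * (C * sup_norm (\<lambda>u. f u - T f u))"
        using t by (intro omega2_le second_difference_le) auto
      then show "1 / (4 * C) * omega2 f t \<le> sup_norm (\<lambda>u. f u - T f u)"
        using C by (simp add: omega field_simps)
      have gM: "\<bar>g u\<bar> \<le> M * omega2 g t" if "u \<in> {0..1}" for u
        using whitney[OF g01 B that] .
      then have "\<bar>T g u\<bar> \<le> M * omega2 g t" if "u \<in> {0..1}" for u
        using that node by (intro T_abs_le) auto
      then have "\<bar>f u - T f u\<bar> \<le> M * omega2 g t + M * omega2 g t" if "u \<in> {0..1}" for u
        using that gM[OF that] unfolding diff[OF that, symmetric]
        by (meson abs_triangle_ineq4 add_mono order_trans)
      then have "sup_norm (\<lambda>u. f u - T f u) \<le> M * omega2 g t + M * omega2 g t"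
        by (rule sup_norm_le)
      then show "sup_norm (\<lambda>u. f u - T f u) \<le> 2 * M * omega2 f t"
        by (simp add: omega)
    qed (use M in simp)
  qed (use C in simp)
qed

end

subsection \<open>The Schoenberg operator\<close>

lemma mono_int_iff_le_succ: "mono f \<longleftrightarrow> (\<forall>j. f j \<le> f (j + 1))"
  for f :: "int \<Rightarrow> 'a::order"
proof
  assume *: "\<forall>j. f j \<le> f (j + 1)"
  show "mono f"
  proof (rule monoI)
    fix i j :: int
    assume "i \<le> j"
    then show "f i \<le> f j"
      by (induction j rule: int_ge_induct) (use * order_trans in blast)+
  qed
qed (simp add: monoD)

text \<open>\<open>knot_sequence\<close> says nothing about indices outside \<open>- k\<close> to
  \<open>n + k\<close>; constant continuation makes the sequence monotone on all integers.\<close>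

definition clamp_knots :: "nat \<Rightarrow> nat \<Rightarrow> (int \<Rightarrow> real) \<Rightarrow> int \<Rightarrow> real" where
  "clamp_knots n k x j = x (max (- int k) (min (int n + int k) j))"

lemma clamp_knots_eq: "- int k \<le> j \<Longrightarrow> j \<le> int n + int k \<Longrightarrow> clamp_knots n k x j = x j"
  by (simp add: clamp_knots_def)

lemma knot_sequence_clamp:
  assumes "knot_sequence n k x"
  shows "knot_sequence n k (clamp_knots n k x)" "mono (clamp_knots n k x)"
proof -
  show "knot_sequence n k (clamp_knots n k x)"
    using assms by (simp add: knot_sequence_def clamp_knots_eq)
  have step: "x j \<le> x (j + 1)" if "- int k \<le> j" "j < int n + int k" for j
  proof -
    consider "j + 1 \<le> 0" | "0 \<le> j" "j < int n" | "int n \<le> j" by linarith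
    then show ?thesis
      using that knot_zero[OF assms] knot_one[OF assms] knot_step[OF assms, of j] by cases auto
  qed
  have "clamp_knots n k x j \<le> clamp_knots n k x (j + 1)" for j
  proof -
    consider "j + 1 \<le> - int k" | "- int k \<le> j" "j < int n + int k" | "int n + int k \<le> j" by linarith
    then show ?thesis
      by cases (use step[of j] in \<open>simp_all add: clamp_knots_eq\<close>, simp_all add: clamp_knots_def)
  qed
  then show "mono (clamp_knots n k x)"
    by (simp add: mono_int_iff_le_succ)
qed

text \<open>For \<open>j \<le> n - 1\<close> the last knot read has index
  \<open>j + k + 1 \<le> n + k\<close>, still inside the unclamped range.\<close>

lemma schoenberg_clamp: "schoenberg n k (clamp_knots n k x) = schoenberg n k x"
proof -
  have "bspline (clamp_knots n k x) j k = bspline x j k"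
    "greville (clamp_knots n k x) j k = greville x j k" if "j \<in> {- int k..int n - 1}" for j
  proof -
    have map_eq: "map (clamp_knots n k x) [j..j + int k + 1] = map x [j..j + int k + 1]"
      using that by (auto simp: clamp_knots_eq)
    show "bspline (clamp_knots n k x) j k = bspline x j k"
      using that unfolding bspline_def by (simp only: map_eq) (simp add: clamp_knots_eq fun_eq_iff)
    show "greville (clamp_knots n k x) j k = greville x j k"
      using that by (auto simp: greville_def clamp_knots_eq intro!: sum.cong)
  qed
  then have "(\<Sum>j=- int k..int n - 1. f (greville (clamp_knots n k x) j k) * bspline (clamp_knots n k x) j k v)
      = (\<Sum>j=- int k..int n - 1. f (greville x j k) * bspline x j k v)" for f v
    by (intro sum.cong) auto
  then show ?thesis
    by (simp add: schoenberg_def fun_eq_iff)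
qed

lemma greville_in_unit_interval:
  assumes "knot_sequence n k x" "mono x" "k > 0" "j \<in> {- int k..int n - 1}"
  shows "greville x j k \<in> {0..1}"
proof -
  have x: "0 \<le> x i \<and> x i \<le> 1" if "i \<in> {j + 1..j + int k}" for i
    using monoD[OF assms(2), of "- int k" i] monoD[OF assms(2), of i "int n + int k"] that assms(4)
      knot_zero[OF assms(1), of "- int k"] knot_one[OF assms(1), of "int n + int k"] by auto
  have "0 \<le> (\<Sum>i=j + 1..j + int k. x i)"
    using x by (intro sum_nonneg) auto
  moreover have "(\<Sum>i=j + 1..j + int k. x i) \<le> (\<Sum>i=j + 1..j + int k. 1)"
    using x by (intro sum_mono) auto
  ultimately show ?thesis
    using assms(3) by (simp add: greville_def)
qed

theorem corollary3:
  fixes n k :: nat and x :: "int \<Rightarrow> real"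
  assumes "n > 0" and "k > 2" and "knot_sequence n k x"
  shows "\<exists>M1>0. \<forall>t. 0 < t \<and> t \<le> 1/2 \<longrightarrow>
           (\<exists>M2>0. \<forall>f :: real \<Rightarrow> real. continuous_on {0..1} f \<longrightarrow>
              M1 * omega2 f t \<le> sup_norm (\<lambda>u. f u - schoenberg n k x f u) \<and>
              sup_norm (\<lambda>u. f u - schoenberg n k x f u) \<le> M2 * omega2 f t)"
proof -
  let ?J = "{- int k..int n - 1}"
  define y where "y = clamp_knots n k x"
  have K: "knot_sequence n k y" "mono y"
    using knot_sequence_clamp[OF assms(3)] by (simp_all add: y_def)
  have k: "k \<ge> 2" "k > 0" using assms(2) by simp_all
  \<comment> \<open>Choice over \<open>u\<close> alone yields weights that serve every
    \<open>f\<close>, as the locale requires.\<close>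
  from bchoice[OF schoenberg_representation[OF K k(1)]]
  obtain w where w: "\<forall>u\<in>{0..1}.
     (\<forall>j\<in>?J. 0 \<le> w u j) \<and> (\<Sum>j\<in>?J. w u j) = 1 \<and> (\<Sum>j\<in>?J. greville y j k * w u j) = u \<and>
     (0 < u \<and> u < 1 \<longrightarrow> 0 < (\<Sum>j\<in>?J. (greville y j k - u)\<^sup>2 * w u j)) \<and>
     (\<forall>f. schoenberg n k y f u = (\<Sum>j\<in>?J. f (greville y j k) * w u j))" ..
  interpret averaging_operator ?J "\<lambda>j. greville y j k" w
    using w greville_in_unit_interval[OF K k(2)] by unfold_locales auto
  have "sup_norm (\<lambda>u. f u - schoenberg n k x f u) = sup_norm (\<lambda>u. f u - T f u)" for f
    unfolding sup_norm_def schoenberg_clamp[of n k x, symmetric] y_def[symmetric]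
    by (intro SUP_cong) (auto simp: T_def w)
  with equivalence show ?thesis by simp
qed

end
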